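(* Let $n\ge1$, ${\bf x}=(x_1,\dots,x_n)$, $\overline{x}_k=x_k^{-1}$, ${\bf a}=(a_1,a_2,\ldots)$ with the convention $a_m=0$ for $m\le0$, and $\lambda$ a partition with at most $n$ parts. For $T\in{\cal T}^{eo}_\lambda$ let ${\rm bar}(T)$ be the number of entries $T_{k,1}=\overline{k}$ in the first column of $T$, and let $\zeta(T)$ be the number of $k$ such that $T_{k-1,1}=k$ and $T_{k,1}=\overline{k}$. Then, if $\ell(\lambda)<n$, $$so_\lambda({\bf x},\overline{{\bf x}}|{\bf a})=\sum_{T\in{\cal T}^{eo}_\lambda}2^{\zeta(T)}\prod_{(i,j)\in F^\lambda}{\rm wgt}(T_{ij}),$$ and if $\ell(\lambda)=n$, $$so_{\lambda_\pm}({\bf x},\overline{{\bf x}}|{\bf a})=\sum_{T\in{\cal T}^{eo}_\lambda}\Big(\theta_{\zeta(T)}\,2^{\zeta(T)-1}+\delta_{\zeta(T),0}\,\epsilon_\pm(T)\Big)\prod_{(i,j)\in F^\lambda}{\rm wgt}(T_{ij}),$$ where $\theta_{\zeta}=1$ if $\zeta>0$ and $0$ otherwise, $\delta_{\zeta,0}=1$ if $\zeta=0$ and $0$ otherwise, $\epsilon_\pm(T)=\tfrac12(1\pm(-1)^{{\rm bar}(T)})$, an entry $T_{ij}=k$ has weight $x_k+a_{2k-1-n+j-i+\delta_{ik}}$ ($\delta_{ik}=1$ if $i=k$, else $0$) and an entry $T_{ij}=\overline{k}$ has weight $\overline{x}_k+a_{2k-n+j-i}$.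
   Context: For an indeterminate $y$ and integer $m\ge0$, $(y|{\bf a})^m=(y+a_1)\cdots(y+a_m)$ for $m>0$, $(y|{\bf a})^0=1$. Define ($n\times n$ determinants, $(i,j)$ entry shown) $o_\lambda({\bf x},\overline{{\bf x}}|{\bf a})=\eta\left|(x_i|{\bf a})^{\lambda_j+n-j}+(\overline{x}_i|{\bf a})^{\lambda_j+n-j}\right|/\big(\tfrac12\left|(x_i|{\bf a})^{n-j}+(\overline{x}_i|{\bf a})^{n-j}\right|\big)$ with $\eta=\tfrac12$ if $\lambda_n=0$, $\eta=1$ if $\lambda_n>0$, and $o'_\lambda({\bf x},\overline{{\bf x}}|{\bf a})=\left|(x_i|{\bf a})^{\lambda_j+n-j}-(\overline{x}_i|{\bf a})^{\lambda_j+n-j}\right|/\big(\tfrac12\left|(x_i|{\bf a})^{n-j}+(\overline{x}_i|{\bf a})^{n-j}\right|\big)$. The factorial $so(2n)$ characters are: for $\ell(\lambda)<n$, $so_\lambda({\bf x},\overline{{\bf x}}|{\bf a})=o_\lambda({\bf x},\overline{{\bf x}}|{\bf a})$; for $\ell(\lambda)=n$, with $\lambda_\pm=(\lambda_1,\dots,\lambda_{n-1},\pm\lambda_n)$, $so_{\lambda_\pm}({\bf x},\overline{{\bf x}}|{\bf a})=\tfrac12\big(o_\lambda({\bf x},\overline{{\bf x}}|{\bf a})\pm o'_\lambda({\bf x},\overline{{\bf x}}|{\bf a})\big)$. $F^\lambda=\{(i,j):1\le i\le\ell(\lambda),1\le j\le\lambda_i\}$. ${\cal T}^{eo}_\lambda$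 is the set of fillings $T$ of $F^\lambda$ with entries $T_{ij}$ from $\{1<\overline{1}<2<\overline{2}<\cdots<n<\overline{n}\}$ such that: entries weakly increase along rows and down columns; no two identical entries in any column; neither $k$ nor $\overline{k}$ appears lower than row $k$; and if an entry $k$ appears in row $k$ then any entry $\overline{k}$ in that row has an entry $k$ immediately above it in row $k-1$. *)

theory Defs
  imports "Jordan_Normal_Form.Determinant" "HOL-Library.FuncSet"
begin

text \<open>
  A partition is a function \<open>lam :: nat \<Rightarrow> nat\<close> whose parts are \<open>lam 1 \<ge> lam 2 \<ge> \<dots>\<close>;
  the value \<open>lam 0\<close> is irrelevant. Variables \<open>x\<close> and parameters \<open>a\<close> are indexed from 1 as well,
  and \<open>a\<close> is extended to all integers.
\<close>

definition is_partition :: "(nat \<Rightarrow> nat) \<Rightarrow> bool" where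
  "is_partition lam \<longleftrightarrow> (\<forall>i\<ge>1. lam (i + 1) \<le> lam i) \<and> finite {i. 1 \<le> i \<and> 0 < lam i}"

definition part_length :: "(nat \<Rightarrow> nat) \<Rightarrow> nat" where
  "part_length lam = card {i. 1 \<le> i \<and> 0 < lam i}"

definition diagram :: "(nat \<Rightarrow> nat) \<Rightarrow> (nat \<times> nat) set" where
  "diagram lam = {(i, j). 1 \<le> i \<and> i \<le> part_length lam \<and> 1 \<le> j \<and> j \<le> lam i}"


definition fpow :: "(int \<Rightarrow> 'a::comm_ring_1) \<Rightarrow> 'a \<Rightarrow> nat \<Rightarrow> 'a" where
  "fpow a y m = (\<Prod>l = 1..m. y + a (int l))"

text \<open>
  Matrices of \<^theory>\<open>Jordan_Normal_Form.Matrix\<close> are indexed from 0, so row \<open>i\<close> and column \<open>j\<close>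
  below are row \<open>i + 1\<close> and column \<open>j + 1\<close> in the 1-based indexing of \<open>x\<close> and \<open>lam\<close>.
\<close>

definition det_plus :: "nat \<Rightarrow> (nat \<Rightarrow> 'a::field) \<Rightarrow> (int \<Rightarrow> 'a) \<Rightarrow> (nat \<Rightarrow> nat) \<Rightarrow> 'a" where
  "det_plus n x a lam = det (mat n n (\<lambda>(i, j).
     fpow a (x (i + 1)) (lam (j + 1) + n - (j + 1))
     + fpow a (inverse (x (i + 1))) (lam (j + 1) + n - (j + 1))))"

definition det_minus :: "nat \<Rightarrow> (nat \<Rightarrow> 'a::field) \<Rightarrow> (int \<Rightarrow> 'a) \<Rightarrow> (nat \<Rightarrow> nat) \<Rightarrow> 'a" where
  "det_minus n x a lam = det (mat n n (\<lambda>(i, j).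
     fpow a (x (i + 1)) (lam (j + 1) + n - (j + 1))
     - fpow a (inverse (x (i + 1))) (lam (j + 1) + n - (j + 1))))"

definition so_denom :: "nat \<Rightarrow> (nat \<Rightarrow> 'a::field) \<Rightarrow> (int \<Rightarrow> 'a) \<Rightarrow> 'a" where
  "so_denom n x a = 1 / 2 * det (mat n n (\<lambda>(i, j).
     fpow a (x (i + 1)) (n - (j + 1)) + fpow a (inverse (x (i + 1))) (n - (j + 1))))"

definition o_char :: "nat \<Rightarrow> (nat \<Rightarrow> 'a::field) \<Rightarrow> (int \<Rightarrow> 'a) \<Rightarrow> (nat \<Rightarrow> nat) \<Rightarrow> 'a" where
  "o_char n x a lam = (if lam n = 0 then 1 / 2 else 1) * det_plus n x a lam / so_denom n x a"

definition o'_char :: "nat \<Rightarrow> (nat \<Rightarrow> 'a::field) \<Rightarrow> (int \<Rightarrow> 'a) \<Rightarrow> (nat \<Rightarrow> nat) \<Rightarrow> 'a" where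
  "o'_char n x a lam = det_minus n x a lam / so_denom n x a"

text \<open>
  The factorial \<open>so(2n)\<close> character of a weight \<open>\<mu>\<close> whose last part \<open>\<mu> n\<close> may be negative;
  \<open>lam\<close> is the underlying partition.
\<close>

definition so_char :: "nat \<Rightarrow> (nat \<Rightarrow> 'a::field) \<Rightarrow> (int \<Rightarrow> 'a) \<Rightarrow> (nat \<Rightarrow> int) \<Rightarrow> 'a" where
  "so_char n x a \<mu> =
     (let lam = (\<lambda>i. nat \<bar>\<mu> i\<bar>) in
      if part_length lam < n then o_char n x a lam
      else if 0 < \<mu> n then 1 / 2 * (o_char n x a lam + o'_char n x a lam)
      else 1 / 2 * (o_char n x a lam - o'_char n x a lam))"

definition weight_plus :: "(nat \<Rightarrow> nat) \<Rightarrow> nat \<Rightarrow> int" where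
  "weight_plus lam = (\<lambda>i. int (lam i))"

definition weight_minus :: "nat \<Rightarrow> (nat \<Rightarrow> nat) \<Rightarrow> nat \<Rightarrow> int" where
  "weight_minus n lam = (\<lambda>i. int (lam i))(n := - int (lam n))"


datatype letter = Unbarred nat | Barred nat

text \<open>The order \<open>1 < 1' < 2 < 2' < \<dots>\<close>, where \<open>k'\<close> stands for \<open>Barred k\<close>.\<close>

fun letter_rank :: "letter \<Rightarrow> nat" where
  "letter_rank (Unbarred k) = 2 * k"
| "letter_rank (Barred k) = 2 * k + 1"

lemma letter_rank_eq_iff: "letter_rank s = letter_rank t \<longleftrightarrow> s = t"
  by (cases s; cases t) (auto, presburger+)

instantiation letter :: linorder
begin

definition less_eq_letter :: "letter \<Rightarrow> letter \<Rightarrow> bool" where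
  "s \<le> t \<longleftrightarrow> letter_rank s \<le> letter_rank t"

definition less_letter :: "letter \<Rightarrow> letter \<Rightarrow> bool" where
  "s < t \<longleftrightarrow> letter_rank s < letter_rank t"

instance
  by standard (auto simp: less_eq_letter_def less_letter_def letter_rank_eq_iff)

end

definition letters :: "nat \<Rightarrow> letter set" where
  "letters n = Unbarred ` {1..n} \<union> Barred ` {1..n}"

text \<open>
  Fillings are extensional functions, so that each filling of the diagram is counted once.
  In the last condition the box \<open>(k - 1, j')\<close> is outside the diagram if \<open>k = 1\<close>.
\<close>

definition eo_tableaux :: "nat \<Rightarrow> (nat \<Rightarrow> nat) \<Rightarrow> (nat \<times> nat \<Rightarrow> letter) set" where
  "eo_tableaux n lam = {T \<in> diagram lam \<rightarrow>\<^sub>E letters n.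
     (\<forall>i j j'. (i, j) \<in> diagram lam \<and> (i, j') \<in> diagram lam \<and> j \<le> j' \<longrightarrow> T (i, j) \<le> T (i, j')) \<and>
     (\<forall>i i' j. (i, j) \<in> diagram lam \<and> (i', j) \<in> diagram lam \<and> i \<le> i' \<longrightarrow> T (i, j) \<le> T (i', j)) \<and>
     (\<forall>i i' j. (i, j) \<in> diagram lam \<and> (i', j) \<in> diagram lam \<and> i \<noteq> i' \<longrightarrow> T (i, j) \<noteq> T (i', j)) \<and>
     (\<forall>i j k. (i, j) \<in> diagram lam \<and> (T (i, j) = Unbarred k \<or> T (i, j) = Barred k) \<longrightarrow> i \<le> k) \<and>
     (\<forall>k j j'. (k, j) \<in> diagram lam \<and> T (k, j) = Unbarred k \<and>
        (k, j') \<in> diagram lam \<and> T (k, j') = Barred k \<longrightarrow>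
        (k - 1, j') \<in> diagram lam \<and> T (k - 1, j') = Unbarred k)}"

definition bar_count :: "(nat \<Rightarrow> nat) \<Rightarrow> (nat \<times> nat \<Rightarrow> letter) \<Rightarrow> nat" where
  "bar_count lam T = card {k. (k, 1) \<in> diagram lam \<and> T (k, 1) = Barred k}"

definition zeta_count :: "(nat \<Rightarrow> nat) \<Rightarrow> (nat \<times> nat \<Rightarrow> letter) \<Rightarrow> nat" where
  "zeta_count lam T = card {k. (k - 1, 1) \<in> diagram lam \<and> (k, 1) \<in> diagram lam \<and>
     T (k - 1, 1) = Unbarred k \<and> T (k, 1) = Barred k}"

fun wgt :: "nat \<Rightarrow> (nat \<Rightarrow> 'a::field) \<Rightarrow> (int \<Rightarrow> 'a) \<Rightarrow> nat \<Rightarrow> nat \<Rightarrow> letter \<Rightarrow> 'a" where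
  "wgt n x a i j (Unbarred k) =
     x k + a (2 * int k - 1 - int n + int j - int i + of_bool (i = k))"
| "wgt n x a i j (Barred k) =
     inverse (x k) + a (2 * int k - int n + int j - int i)"

definition tab_wgt ::
  "nat \<Rightarrow> (nat \<Rightarrow> 'a::field) \<Rightarrow> (int \<Rightarrow> 'a) \<Rightarrow> (nat \<Rightarrow> nat) \<Rightarrow> (nat \<times> nat \<Rightarrow> letter) \<Rightarrow> 'a" where
  "tab_wgt n x a lam T = (\<Prod>(i, j) \<in> diagram lam. wgt n x a i j (T (i, j)))"

end

(*
  Both statements are the cases e = 1 and e = -1 of one identity. For n variables let
  N_e(lam) be the determinant of the entries (x_i|a)^(lam_j+n-j) + e (1/x_i|a)^(lam_j+n-j), and let
  S_e(lam) be the sum over the tableaux T of (1+e)^zeta(T) e^bar(T) wgt(T). Then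
    N_e(lam) = (1 + e if lam_n = 0, else 1) * prod_{i<j} (z_i - z_j) * S_e(lam),  z_i = x_i + 1/x_i,
  and the denominator is this product, by the case e = 1, lam = 0. Half the sum and half the
  difference of S_1 and S_(-1) have the coefficients of the theorem.

  The identity follows by induction on n, with a replaced by its shift a_(m-1). A row operation
  extracts the factors z_i - z_n. Put t = x_n. Column operations with the factors 1/t + a_l make
  every column but the last one a sum over one box at a time, and multilinearity yields a sum over
  the shapes N of the entries smaller than Barred n. Column operations with the factors t + a_l
  then yield in the same way the sum over the shapes M of the entries smaller than Unbarred n.
  Because the columns are differences of consecutive terms, the two sums run exactly over the
  interlacing shapes. The remaining two columns combine to the weight of row n.
*)
theory Submission
  imports Defs
begin

subsection \<open>Factorial powers\<close>

definition seg :: "(int \<Rightarrow> 'a::comm_ring_1) \<Rightarrow> 'a \<Rightarrow> nat \<Rightarrow> nat \<Rightarrow> 'a" where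
  "seg a y p m = (\<Prod>l\<in>{p<..m}. y + a (int l))"

lemma fpow_eq_seg: "fpow a y m = seg a y 0 m"
  unfolding fpow_def seg_def by (rule prod.cong) auto

lemma seg_trivial [simp]: "m \<le> p \<Longrightarrow> seg a y p m = 1"
  by (simp add: seg_def)

lemma seg_Suc: "p \<le> m \<Longrightarrow> seg a y p (Suc m) = (y + a (int (Suc m))) * seg a y p m"
proof -
  assume "p \<le> m"
  then have "{p<..Suc m} = insert (Suc m) {p<..m}" by auto
  then show ?thesis by (simp add: seg_def)
qed

lemma seg_mult: "p \<le> q \<Longrightarrow> q \<le> m \<Longrightarrow> seg a y p q * seg a y q m = seg a y p m"
proof -
  assume "p \<le> q" "q \<le> m"
  then have "{p<..m} = {p<..q} \<union> {q<..m}" by auto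
  then show ?thesis by (simp add: seg_def prod.union_disjoint)
qed

lemma solve_recurrence:
  assumes rec: "\<And>l. X (Suc l) = (s + a (int (Suc l))) * X l + Y l" and "l' \<le> l"
  shows "X l = seg a s l' l * X l' + (\<Sum>m\<in>{l'..<l}. seg a s (Suc m) l * Y m)"
  using \<open>l' \<le> l\<close>
proof (induction l rule: dec_induct)
  case base
  show ?case by simp
next
  case (step l)
  have "(\<Sum>m\<in>{l'..<Suc l}. seg a s (Suc m) (Suc l) * Y m)
      = (s + a (int (Suc l))) * (\<Sum>m\<in>{l'..<l}. seg a s (Suc m) l * Y m) + Y l"
    using step.hyps by (simp add: seg_Suc sum_distrib_left mult_ac cong: sum.cong_simp)
  then show ?case
    using step by (simp add: rec seg_Suc algebra_simps)
qed

definition pair_pow :: "(int \<Rightarrow> 'a::field) \<Rightarrow> 'a \<Rightarrow> 'a \<Rightarrow> nat \<Rightarrow> 'a" where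
  "pair_pow a e y l = fpow a y l + e * fpow a (inverse y) l"

text \<open>
  For \<open>p > 0\<close> this is \<open>pair_pow\<close> for the parameters \<open>m \<mapsto> a (m - 1)\<close> (lemma \<open>pair_pow_shift\<close>);
  for \<open>p = 0\<close> it is half of it, which is what the division by \<open>z - z\<^sub>n\<close> produces.
\<close>
definition shift_pow :: "(int \<Rightarrow> 'a::field) \<Rightarrow> 'a \<Rightarrow> 'a \<Rightarrow> nat \<Rightarrow> 'a" where
  "shift_pow a e y p = (if p = 0 then (1 + e) / 2
     else y * fpow a y (p - 1) + e * (inverse y * fpow a (inverse y) (p - 1)))"

text \<open>
  With \<open>z = y + 1/y\<close> and \<open>z\<^sub>n = t + 1/t\<close>, the function \<open>pair_pow a e y l\<close> is
  \<open>(z - z\<^sub>n) * outer_sum a e t y l\<close> up to a term that a row operation removes. The outer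
  recurrence, in \<open>1/t\<close>, produces the boxes that contain \<open>Barred n\<close>, the inner one, in \<open>t\<close>, those
  that contain \<open>Unbarred n\<close>.
\<close>
definition inner_sum :: "(int \<Rightarrow> 'a::field) \<Rightarrow> 'a \<Rightarrow> 'a \<Rightarrow> 'a \<Rightarrow> nat \<Rightarrow> 'a" where
  "inner_sum a e t y m = (\<Sum>p\<le>m. seg a t p m * shift_pow a e y p)"

definition outer_sum :: "(int \<Rightarrow> 'a::field) \<Rightarrow> 'a \<Rightarrow> 'a \<Rightarrow> 'a \<Rightarrow> nat \<Rightarrow> 'a" where
  "outer_sum a e t y l = (\<Sum>m<l. seg a (inverse t) (Suc m) l * inner_sum a e t y m)"

lemma inner_sum_0 [simp]: "inner_sum a e t y 0 = (1 + e) / 2"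
  by (simp add: inner_sum_def shift_pow_def)

lemma outer_sum_0 [simp]: "outer_sum a e t y 0 = 0"
  by (simp add: outer_sum_def)

lemma inner_sum_Suc:
  "inner_sum a e t y (Suc m) = (t + a (int (Suc m))) * inner_sum a e t y m + shift_pow a e y (Suc m)"
  by (simp add: inner_sum_def seg_Suc sum_distrib_left mult_ac cong: sum.cong_simp)

lemma outer_sum_Suc:
  "outer_sum a e t y (Suc l)
     = (inverse t + a (int (Suc l))) * outer_sum a e t y l + inner_sum a e t y l"
  by (simp add: outer_sum_def seg_Suc sum_distrib_left mult_ac lessThan_Suc cong: sum.cong_simp)

lemma outer_sum_closed:
  "(t - inverse t) * outer_sum a e t y l
     = (\<Sum>q\<le>l. (seg a t q l - seg a (inverse t) q l) * shift_pow a e y q)"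
proof (induction l)
  case 0
  then show ?case by simp
next
  case (Suc l)
  let ?b = "inverse t"
  have "(\<Sum>q\<le>Suc l. (seg a t q (Suc l) - seg a ?b q (Suc l)) * shift_pow a e y q)
     = (\<Sum>q\<le>l. (seg a t q (Suc l) - seg a ?b q (Suc l)) * shift_pow a e y q)"
    by simp
  also have "\<dots> = (\<Sum>q\<le>l. (?b + a (int (Suc l))) * ((seg a t q l - seg a ?b q l) * shift_pow a e y q)
       + (t - ?b) * (seg a t q l * shift_pow a e y q))"
    by (rule sum.cong) (auto simp: seg_Suc algebra_simps)
  also have "\<dots> = (?b + a (int (Suc l))) * ((t - ?b) * outer_sum a e t y l) + (t - ?b) * inner_sum a e t y l"
    by (simp only: sum.distrib sum_distrib_left[symmetric] Suc inner_sum_def)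
  also have "\<dots> = (t - ?b) * outer_sum a e t y (Suc l)"
    by (simp add: outer_sum_Suc algebra_simps)
  finally show ?case by simp
qed

text \<open>
  Total weight of row \<open>n\<close> of length \<open>l\<close> when row \<open>n - 1\<close> has \<open>q\<close> letters smaller than
  \<open>Unbarred n\<close>: either \<open>min q l\<close> copies of \<open>Unbarred n\<close> come first, or there are none, with the
  sign \<open>e\<close>. For \<open>l = 0\<close> the empty row is thus counted \<open>1 + e\<close> times.
\<close>
definition row_factor :: "(int \<Rightarrow> 'a::field) \<Rightarrow> 'a \<Rightarrow> 'a \<Rightarrow> nat \<Rightarrow> nat \<Rightarrow> 'a" where
  "row_factor a e t q l =
     fpow a t (min q l) * seg a (inverse t) (min q l) l + e * fpow a (inverse t) l"

lemma row_factor_expansion: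
  assumes "l \<le> m"
  shows "pair_pow a e t l * inner_sum a e t y m
       - (t - inverse t) * fpow a t m * outer_sum a e t y l
     = (\<Sum>q\<le>m. seg a t q m * row_factor a e t q l * shift_pow a e y q)"
proof -
  let ?b = "inverse t"
  have "(t - ?b) * outer_sum a e t y l
      = (\<Sum>q\<le>m. (if q \<le> l then (seg a t q l - seg a ?b q l) * shift_pow a e y q else 0))"
    unfolding outer_sum_closed using assms by (intro sum.mono_neutral_cong_left) auto
  then have "pair_pow a e t l * inner_sum a e t y m
       - (t - inverse t) * fpow a t m * outer_sum a e t y l
     = (\<Sum>q\<le>m. pair_pow a e t l * (seg a t q m * shift_pow a e y q)
         - fpow a t m * (if q \<le> l then (seg a t q l - seg a ?b q l) * shift_pow a e y q else 0))"
    by (simp add: inner_sum_def sum_subtractf sum_distrib_left mult_ac)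
  also have "\<dots> = (\<Sum>q\<le>m. seg a t q m * row_factor a e t q l * shift_pow a e y q)"
  proof (rule sum.cong)
    fix q assume "q \<in> {..m}"
    show "pair_pow a e t l * (seg a t q m * shift_pow a e y q)
         - fpow a t m * (if q \<le> l then (seg a t q l - seg a ?b q l) * shift_pow a e y q else 0)
       = seg a t q m * row_factor a e t q l * shift_pow a e y q"
    proof (cases "q \<le> l")
      case True
      have 1: "fpow a t l = fpow a t q * seg a t q l" "fpow a t m = fpow a t q * seg a t q m"
        unfolding fpow_eq_seg using True assms by (auto simp: seg_mult)
      show ?thesis
        using True by (simp add: pair_pow_def row_factor_def 1 min_def algebra_simps)
    next
      case False
      then show ?thesis
        by (simp add: pair_pow_def row_factor_def min_def algebra_simps)
    qed
  qed simp
  finally show ?thesis .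
qed

lemma fpow_0 [simp]: "fpow a y 0 = 1"
  by (simp add: fpow_def)

lemma fpow_Suc: "fpow a y (Suc m) = (y + a (int (Suc m))) * fpow a y m"
  by (simp add: fpow_eq_seg seg_Suc)

lemma factor_common:
  fixes y :: "'a::comm_ring_1"
  assumes "t * b = 1" "y * z = 1"
  shows "(y - b) * (y - t) = (y + z - t - b) * y"
proof -
  have "(y - b) * (y - t) - (y + z - t - b) * y = t * b - y * z"
    by (simp add: algebra_simps)
  then show ?thesis by (simp add: assms)
qed

lemma pair_pow_decomposition_plus:
  fixes t :: "'a::field_char_0"
  assumes "t \<noteq> 0" "y \<noteq> 0"
  shows "pair_pow a 1 y l = (y + inverse y - t - inverse t) * outer_sum a 1 t y l + pair_pow a 1 t l"
proof -
  let ?b = "inverse t" and ?z = "inverse y" and ?D = "y + inverse y - t - inverse t"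
  have tb: "t * ?b = 1" "y * ?z = 1" using assms by auto
  have aux: "(y - ?b) * fpow a y l + (?z - ?b) * fpow a ?z l
      = ?D * inner_sum a 1 t y l + (t - ?b) * fpow a t l" for l
  proof (induction l)
    case 0
    then show ?case by simp
  next
    case (Suc l)
    let ?A = "a (int (Suc l))"
    have *: "(y - ?b) * (y - t) = ?D * y" "(?z - ?b) * (?z - t) = ?D * ?z"
      using factor_common[OF tb] factor_common[OF tb(1), of ?z y] tb(2) by (simp_all only: mult.commute[of ?z y] add.commute[of ?z y])
    have "(y - ?b) * fpow a y (Suc l) + (?z - ?b) * fpow a ?z (Suc l)
      = (t + ?A) * ((y - ?b) * fpow a y l + (?z - ?b) * fpow a ?z l)
       + ((y - ?b) * (y - t)) * fpow a y l + ((?z - ?b) * (?z - t)) * fpow a ?z l"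
      by (simp add: fpow_Suc algebra_simps)
    also have "\<dots> = ?D * inner_sum a 1 t y (Suc l) + (t - ?b) * fpow a t (Suc l)"
      unfolding Suc * by (simp add: fpow_Suc inner_sum_Suc shift_pow_def algebra_simps)
    finally show ?case .
  qed
  show ?thesis
  proof (induction l)
    case 0
    then show ?case by (simp add: pair_pow_def)
  next
    case (Suc l)
    let ?A = "a (int (Suc l))"
    have "pair_pow a 1 y (Suc l) = (?b + ?A) * pair_pow a 1 y l
       + ((y - ?b) * fpow a y l + (?z - ?b) * fpow a ?z l)"
      by (simp add: pair_pow_def fpow_Suc algebra_simps)
    then show ?case
      unfolding aux Suc
      by (simp add: pair_pow_def fpow_Suc outer_sum_Suc algebra_simps)
  qed
qed

lemma pair_pow_decomposition_minus:
  fixes t :: "'a::field_char_0"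
  assumes "t \<noteq> 0"
  obtains w where "\<And>l. pair_pow a (- 1) t l = (t - inverse t) * w l"
    and "\<And>y l. y \<noteq> 0 \<Longrightarrow> pair_pow a (- 1) y l
       = (y + inverse y - t - inverse t) * outer_sum a (- 1) t y l + (y - inverse y) * w l"
proof
  let ?b = "inverse t"
  define w where "w l = (\<Sum>m<l. seg a ?b (Suc m) l * fpow a t m)" for l
  have w_Suc: "w (Suc l) = (?b + a (int (Suc l))) * w l + fpow a t l" for l
    by (simp add: w_def seg_Suc sum_distrib_left mult_ac lessThan_Suc cong: sum.cong_simp)
  have w0: "w 0 = 0" by (simp add: w_def)
  show "pair_pow a (- 1) t l = (t - inverse t) * w l" for l
  proof (induction l)
    case 0
    then show ?case by (simp add: w0 pair_pow_def)
  next
    case (Suc l)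
    have "pair_pow a (- 1) t (Suc l)
      = (?b + a (int (Suc l))) * pair_pow a (- 1) t l + (t - ?b) * fpow a t l"
      by (simp add: pair_pow_def fpow_Suc algebra_simps)
    then show ?case
      unfolding Suc by (simp add: w_Suc algebra_simps)
  qed
  fix y :: 'a and l assume "y \<noteq> 0"
  let ?z = "inverse y" and ?D = "y + inverse y - t - inverse t"
  have tb: "t * ?b = 1" "y * ?z = 1" using assms \<open>y \<noteq> 0\<close> by auto
  have aux: "(y - ?b) * fpow a y l - (?z - ?b) * fpow a ?z l
      = ?D * inner_sum a (- 1) t y l + (y - ?z) * fpow a t l" for l
  proof (induction l)
    case 0
    then show ?case by (simp add: algebra_simps)
  next
    case (Suc l)
    let ?A = "a (int (Suc l))"
    have *: "(y - ?b) * (y - t) = ?D * y" "(?z - ?b) * (?z - t) = ?D * ?z"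
      using factor_common[OF tb] factor_common[OF tb(1), of ?z y] tb(2) by (simp_all only: mult.commute[of ?z y] add.commute[of ?z y])
    have "(y - ?b) * fpow a y (Suc l) - (?z - ?b) * fpow a ?z (Suc l)
      = (t + ?A) * ((y - ?b) * fpow a y l - (?z - ?b) * fpow a ?z l)
       + ((y - ?b) * (y - t)) * fpow a y l - ((?z - ?b) * (?z - t)) * fpow a ?z l"
      by (simp add: fpow_Suc algebra_simps)
    also have "\<dots> = ?D * inner_sum a (- 1) t y (Suc l) + (y - ?z) * fpow a t (Suc l)"
      unfolding Suc * by (simp add: fpow_Suc inner_sum_Suc shift_pow_def algebra_simps)
    finally show ?case .
  qed
  show "pair_pow a (- 1) y l = ?D * outer_sum a (- 1) t y l + (y - ?z) * w l"
  proof (induction l)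
    case 0
    then show ?case by (simp add: pair_pow_def w0)
  next
    case (Suc l)
    let ?A = "a (int (Suc l))"
    have "pair_pow a (- 1) y (Suc l) = (?b + ?A) * pair_pow a (- 1) y l
       + ((y - ?b) * fpow a y l - (?z - ?b) * fpow a ?z l)"
      by (simp add: pair_pow_def fpow_Suc algebra_simps)
    then show ?case
      unfolding aux Suc
      by (simp add: fpow_Suc outer_sum_Suc w_Suc algebra_simps)
  qed
qed

subsection \<open>Determinants by columns\<close>

text \<open>Columns are indexed from 1, like the parts of a partition, but rows from 0.\<close>
definition cdet :: "nat \<Rightarrow> (nat \<Rightarrow> nat \<Rightarrow> 'a::comm_ring_1) \<Rightarrow> 'a" where
  "cdet n v = det (mat n n (\<lambda>(i, j). v (Suc j) i))"

lemma cdet_cong: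
  assumes "\<And>j i. 1 \<le> j \<Longrightarrow> j \<le> n \<Longrightarrow> i < n \<Longrightarrow> v j i = v' j i"
  shows "cdet n v = cdet n v'"
  unfolding cdet_def by (rule arg_cong[where f = det]) (auto intro!: eq_matI assms)

lemma cdet_leibniz:
  "cdet n v = (\<Sum>p | p permutes {0..<n}. signof p * (\<Prod>j=1..n. v j (p (j - 1))))"
proof -
  have "p permutes {0..<n} \<Longrightarrow>
      (\<Prod>j<n. mat n n (\<lambda>(i, j). v (Suc j) i) $$ (p j, j)) = (\<Prod>j=1..n. v j (p (j - 1)))" for p
    unfolding One_nat_def prod.atLeast1_atMost_eq
    by (rule prod.cong) (auto dest: permutes_in_image)
  then show ?thesis
    unfolding cdet_def by (subst det_col[of _ n]) auto
qed

lemma cdet_linear: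
  fixes U :: "nat \<Rightarrow> 'b \<Rightarrow> nat \<Rightarrow> 'a::comm_ring_1"
  assumes J: "J \<subseteq> {1..n}" and A: "\<And>j. j \<in> J \<Longrightarrow> finite (A j)"
  shows "cdet n (\<lambda>j i. if j \<in> J then \<Sum>s\<in>A j. c j s * U j s i else W j i)
    = (\<Sum>s\<in>Pi\<^sub>E J A. (\<Prod>j\<in>J. c j (s j)) * cdet n (\<lambda>j i. if j \<in> J then U j (s j) i else W j i))"
proof -
  have fJ: "finite J" using J finite_subset by blast
  have split: "(\<Prod>j=1..n. if j \<in> J then f j else g j) = (\<Prod>j\<in>J. f j) * (\<Prod>j\<in>{1..n} - J. g j)"
    for f g :: "nat \<Rightarrow> 'a"
  proof -
    have "{1..n} \<inter> {j. j \<in> J} = J" "{1..n} \<inter> - {j. j \<in> J} = {1..n} - J"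
      using J by auto
    then show ?thesis by (subst prod.If_cases) auto
  qed
  have "cdet n (\<lambda>j i. if j \<in> J then \<Sum>s\<in>A j. c j s * U j s i else W j i)
    = (\<Sum>p | p permutes {0..<n}. \<Sum>s\<in>Pi\<^sub>E J A. signof p *
        ((\<Prod>j\<in>J. c j (s j)) * (\<Prod>j\<in>J. U j (s j) (p (j - 1))) * (\<Prod>j\<in>{1..n} - J. W j (p (j - 1)))))"
    unfolding cdet_leibniz split
    by (simp add: prod_sum_PiE[OF fJ A] sum_distrib_left sum_distrib_right prod.distrib mult.assoc)
  also have "\<dots> = (\<Sum>s\<in>Pi\<^sub>E J A. \<Sum>p | p permutes {0..<n}. signof p *
        ((\<Prod>j\<in>J. c j (s j)) * (\<Prod>j\<in>J. U j (s j) (p (j - 1))) * (\<Prod>j\<in>{1..n} - J. W j (p (j - 1)))))"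
    by (rule sum.swap)
  also have "\<dots> = (\<Sum>s\<in>Pi\<^sub>E J A. (\<Prod>j\<in>J. c j (s j)) *
       cdet n (\<lambda>j i. if j \<in> J then U j (s j) i else W j i))"
    unfolding cdet_leibniz split by (simp add: sum_distrib_left mult_ac)
  finally show ?thesis .
qed

lemma cdet_column_operation:
  assumes "r < n"
  shows "cdet n (\<lambda>j i. if j \<le> r then v j i - c j * v (Suc j) i else v j i) = cdet n v"
proof -
  define L where "L = mat n n (\<lambda>(i, j). if i = j then 1 else if i = Suc j \<and> j < r then - c i else 0)"
  let ?V = "mat n n (\<lambda>(i, j). v (Suc j) i)"
  have "mat n n (\<lambda>(i, j). if Suc j \<le> r then v (Suc j) i - c (Suc j) * v (Suc (Suc j)) i else v (Suc j) i)
      = ?V * L"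
  proof (rule eq_matI)
    fix i j assume "i < dim_row (?V * L)" "j < dim_col (?V * L)"
    then have ij: "i < n" "j < n" by (auto simp: L_def)
    then have "(?V * L) $$ (i, j)
        = (\<Sum>l\<in>{0..<n}. v (Suc l) i * (if l = j then 1 else if l = Suc j \<and> j < r then - c l else 0))"
      by (simp add: L_def scalar_prod_def cong: sum.cong_simp)
    also have "\<dots> = (\<Sum>l\<in>{0..<n}. (if l = j then v (Suc l) i else 0) +
          (if l = Suc j then (if j < r then - c l * v (Suc l) i else 0) else 0))"
      by (rule sum.cong) auto
    also have "\<dots> = (if Suc j \<le> r then v (Suc j) i - c (Suc j) * v (Suc (Suc j)) i else v (Suc j) i)"
      using ij \<open>r < n\<close> by (simp add: sum.distrib sum.delta)
    finally show "mat n n (\<lambda>(i, j). if Suc j \<le> r then v (Suc j) i - c (Suc j) * v (Suc (Suc j)) i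
        else v (Suc j) i) $$ (i, j) = (?V * L) $$ (i, j)"
      using ij by simp
  qed (simp_all add: L_def)
  moreover have "det L = 1"
  proof -
    have "det L = prod_list (diag_mat L)"
      by (rule det_lower_triangular[of n]) (auto simp: L_def)
    also have "diag_mat L = map (\<lambda>_. 1) [0..<n]"
      by (auto simp: diag_mat_def L_def)
    finally show ?thesis
      by (subst (asm) prod.distinct_set_conv_list[symmetric]) auto
  qed
  ultimately show ?thesis
    unfolding cdet_def by (simp add: det_mult[of _ n] L_def)
qed

lemma cdet_linear_last:
  assumes "1 \<le> n"
  shows "cdet n (\<lambda>j i. if j < n then v j i else b * f i - c * g i)
     = b * cdet n (\<lambda>j i. if j < n then v j i else f i) - c * cdet n (\<lambda>j i. if j < n then v j i else g i)"
proof -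
  obtain k where n: "n = Suc k" using assms by (cases n) auto
  have "cdet n (\<lambda>j i. if j < n then v j i else h i)
     = (\<Sum>p | p permutes {0..<n}. signof p * (\<Prod>j=1..k. v j (p (j - 1))) * h (p k))" for h
    unfolding cdet_leibniz n by (simp add: prod.nat_ivl_Suc' mult_ac cong: prod.cong_simp)
  then show ?thesis
    by (simp add: sum_distrib_left sum_subtractf[symmetric] algebra_simps)
qed

lemma cdet_bottom_row:
  assumes "1 \<le> k" and zero: "\<And>j. 1 \<le> j \<Longrightarrow> j < k \<Longrightarrow> v j k = 0"
  shows "cdet (Suc k) v
     = cdet k (\<lambda>j i. if j < k then v j i else v (Suc k) k * v k i - v k k * v (Suc k) i)"
proof -
  obtain m where k: "k = Suc m" using assms by (cases k) auto
  let ?M = "mat (Suc k) (Suc k) (\<lambda>(i, j). v (Suc j) i)"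
  have zero': "v (Suc i) (Suc m) = 0" if "i < m" for i
    using zero[of "Suc i"] that by (simp add: k)
  have "cdet (Suc k) v = (\<Sum>j<Suc k. ?M $$ (k, j) * cofactor ?M k j)"
    unfolding cdet_def by (rule laplace_expansion_row) auto
  also have "\<dots> = (\<Sum>j\<in>{m, k}. ?M $$ (k, j) * cofactor ?M k j)"
    using zero' by (intro sum.mono_neutral_right) (auto simp: k less_Suc_eq)
  also have "\<dots> = v k k * cofactor ?M k m + v (Suc k) k * cofactor ?M k k"
    by (simp add: k)
  also have "cofactor ?M k k = cdet k (\<lambda>j i. if j < k then v j i else v k i)"
  proof -
    have "mat_delete ?M k k = mat k k (\<lambda>(i, j). if Suc j < k then v (Suc j) i else v k i)"
      unfolding mat_delete_def by (rule eq_matI) (auto simp: k less_Suc_eq)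
    then show ?thesis by (simp add: cofactor_def cdet_def)
  qed
  also have "cofactor ?M k m = - cdet k (\<lambda>j i. if j < k then v j i else v (Suc k) i)"
  proof -
    have "mat_delete ?M k m = mat k k (\<lambda>(i, j). if Suc j < k then v (Suc j) i else v (Suc k) i)"
      unfolding mat_delete_def by (rule eq_matI) (auto simp: k less_Suc_eq)
    then show ?thesis by (simp add: cofactor_def cdet_def k)
  qed
  finally show ?thesis
    by (simp add: cdet_linear_last[OF assms(1)])
qed

lemma cdet_row_operation_aux:
  "cdet (Suc k) (\<lambda>j i. if i < k then d i * g j i + b i * w j else c * w j)
    = c * (\<Prod>i<k. d i) * cdet (Suc k) (\<lambda>j i. if i < k then g j i else w j)"
proof -
  define L where "L = mat (Suc k) (Suc k)
    (\<lambda>(i, j). if i = j then (if i < k then d i else c) else if j = k then b i else 0)"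
  let ?B = "mat (Suc k) (Suc k) (\<lambda>(i, j). if i < k then g (Suc j) i else w (Suc j))"
  have "mat (Suc k) (Suc k) (\<lambda>(i, j). if i < k then d i * g (Suc j) i + b i * w (Suc j) else c * w (Suc j))
      = L * ?B"
  proof (rule eq_matI)
    fix i j assume "i < dim_row (L * ?B)" "j < dim_col (L * ?B)"
    then have ij: "i < Suc k" "j < Suc k" by (auto simp: L_def)
    then have "(L * ?B) $$ (i, j)
      = (\<Sum>l\<in>{0..<Suc k}. (if i = l then (if i < k then d i else c) else if l = k then b i else 0)
        * (if l < k then g (Suc j) l else w (Suc j)))"
      by (simp add: L_def scalar_prod_def del: sum.op_ivl_Suc cong: sum.cong_simp)
    also have "\<dots> = (\<Sum>l\<in>{0..<Suc k}. (if l = i then (if i < k then d i * g (Suc j) i else c * w (Suc j)) else 0)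
        + (if l = k then (if i < k then b i * w (Suc j) else 0) else 0))"
      using ij by (intro sum.cong) auto
    also have "\<dots> = (if i < k then d i * g (Suc j) i + b i * w (Suc j) else c * w (Suc j))"
      using ij by (simp add: sum.distrib sum.delta del: sum.op_ivl_Suc)
    finally show "mat (Suc k) (Suc k) (\<lambda>(i, j). if i < k then d i * g (Suc j) i + b i * w (Suc j)
        else c * w (Suc j)) $$ (i, j) = (L * ?B) $$ (i, j)"
      using ij by simp
  qed (simp_all add: L_def)
  moreover have "det L = c * (\<Prod>i<k. d i)"
  proof -
    have "det L = prod_list (diag_mat L)"
      by (rule det_upper_triangular[of _ "Suc k"]) (auto simp: L_def upper_triangular_def)
    also have "diag_mat L = map (\<lambda>i. if i < k then d i else c) [0..<Suc k]"
      by (auto simp: diag_mat_def L_def)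
    also have "prod_list \<dots> = (\<Prod>i<Suc k. if i < k then d i else c)"
      by (subst prod.distinct_set_conv_list[symmetric]) (auto simp: atLeast0LessThan)
    finally show ?thesis by (simp add: mult.commute)
  qed
  ultimately show ?thesis
    unfolding cdet_def by (simp add: det_mult[of _ "Suc k"] L_def)
qed

lemma cdet_row_operation:
  "cdet (Suc k) (\<lambda>j i. if i < k then d i * g j i + b i * w j else c * w j)
    = (\<Prod>i<k. d i) * cdet (Suc k) (\<lambda>j i. if i < k then g j i else c * w j)"
proof -
  have "cdet (Suc k) (\<lambda>j i. if i < k then g j i else c * w j)
      = c * cdet (Suc k) (\<lambda>j i. if i < k then g j i else w j)"
    using cdet_row_operation_aux[of k "\<lambda>_. 1" g "\<lambda>_. 0" w c] by (simp cong: if_cong)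
  then show ?thesis
    unfolding cdet_row_operation_aux by simp
qed

subsection \<open>Branching of tableaux\<close>

definition rows_diagram :: "nat \<Rightarrow> (nat \<Rightarrow> nat) \<Rightarrow> (nat \<times> nat) set" where
  "rows_diagram n lam = {(i, j). 1 \<le> i \<and> i \<le> n \<and> 1 \<le> j \<and> j \<le> lam i}"

definition eo_fillings :: "nat \<Rightarrow> (nat \<times> nat) set \<Rightarrow> (nat \<times> nat \<Rightarrow> letter) set" where
  "eo_fillings n D = {T \<in> D \<rightarrow>\<^sub>E letters n.
     (\<forall>i j j'. (i, j) \<in> D \<and> (i, j') \<in> D \<and> j \<le> j' \<longrightarrow> T (i, j) \<le> T (i, j')) \<and>
     (\<forall>i i' j. (i, j) \<in> D \<and> (i', j) \<in> D \<and> i < i' \<longrightarrow> T (i, j) < T (i', j)) \<and>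
     (\<forall>i j. (i, j) \<in> D \<longrightarrow> Unbarred i \<le> T (i, j)) \<and>
     (\<forall>k j j'. (k, j) \<in> D \<and> T (k, j) = Unbarred k \<and>
        (k, j') \<in> D \<and> T (k, j') = Barred k \<longrightarrow>
        (k - 1, j') \<in> D \<and> T (k - 1, j') = Unbarred k)}"

lemma eo_fillingsD:
  assumes "T \<in> eo_fillings n D"
  shows eo_fillings_PiE: "T \<in> D \<rightarrow>\<^sub>E letters n"
    and eo_fillings_row: "(i, j) \<in> D \<Longrightarrow> (i, j') \<in> D \<Longrightarrow> j \<le> j' \<Longrightarrow> T (i, j) \<le> T (i, j')"
    and eo_fillings_column: "(i, j) \<in> D \<Longrightarrow> (i', j) \<in> D \<Longrightarrow> i < i' \<Longrightarrow> T (i, j) < T (i', j)"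
    and eo_fillings_lower: "(i, j) \<in> D \<Longrightarrow> Unbarred i \<le> T (i, j)"
    and eo_fillings_above: "(k, j) \<in> D \<Longrightarrow> T (k, j) = Unbarred k \<Longrightarrow> (k, j') \<in> D \<Longrightarrow>
      T (k, j') = Barred k \<Longrightarrow> (k - 1, j') \<in> D \<and> T (k - 1, j') = Unbarred k"
  using assms unfolding eo_fillings_def by (simp_all only: mem_Collect_eq)

definition zetas :: "(nat \<times> nat) set \<Rightarrow> (nat \<times> nat \<Rightarrow> letter) \<Rightarrow> nat set" where
  "zetas D T = {k. (k - 1, 1) \<in> D \<and> (k, 1) \<in> D \<and>
     T (k - 1, 1) = Unbarred k \<and> T (k, 1) = Barred k}"

definition bars :: "(nat \<times> nat) set \<Rightarrow> (nat \<times> nat \<Rightarrow> letter) \<Rightarrow> nat set" where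
  "bars D T = {k. (k, 1) \<in> D \<and> T (k, 1) = Barred k}"

lemma mem_rows_diagram [simp]:
  "(i, j) \<in> rows_diagram n lam \<longleftrightarrow> 1 \<le> i \<and> i \<le> n \<and> 1 \<le> j \<and> j \<le> lam i"
  by (simp add: rows_diagram_def)

lemma rows_diagram_Sigma: "rows_diagram n lam = Sigma {1..n} (\<lambda>i. {1..lam i})"
  by auto

lemma finite_rows_diagram [simp]: "finite (rows_diagram n lam)"
  by (simp add: rows_diagram_Sigma)

lemma rows_diagram_cong:
  "(\<And>i. 1 \<le> i \<Longrightarrow> i \<le> n \<Longrightarrow> lam i = lam' i) \<Longrightarrow> rows_diagram n lam = rows_diagram n lam'"
  by auto

lemma letter_less_simps [simp]:
  "Unbarred c < Unbarred d \<longleftrightarrow> c < d" "Unbarred c < Barred d \<longleftrightarrow> c \<le> d"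
  "Barred c < Unbarred d \<longleftrightarrow> c < d" "Barred c < Barred d \<longleftrightarrow> c < d"
  "Unbarred c \<le> Unbarred d \<longleftrightarrow> c \<le> d" "Unbarred c \<le> Barred d \<longleftrightarrow> c \<le> d"
  "Barred c \<le> Unbarred d \<longleftrightarrow> c < d" "Barred c \<le> Barred d \<longleftrightarrow> c \<le> d"
  by (auto simp: less_letter_def less_eq_letter_def)

lemma letters_Suc:
  "z \<in> letters (Suc k) \<longleftrightarrow> z \<in> letters k \<or> z = Unbarred (Suc k) \<or> z = Barred (Suc k)"
  by (auto simp: letters_def le_Suc_eq image_iff)

lemma letters_less: "z \<in> letters k \<Longrightarrow> k < n \<Longrightarrow> z < Unbarred n"
  by (auto simp: letters_def)

lemma less_in_letters: "z \<in> letters (Suc k) \<Longrightarrow> z < Unbarred (Suc k) \<Longrightarrow> z \<in> letters k"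
  by (auto simp: letters_Suc)

lemma finite_letters [simp]: "finite (letters n)"
  by (simp add: letters_def)

lemma finite_eo_fillings [simp]: "finite (eo_fillings n (rows_diagram n' lam))"
  by (rule finite_subset[of _ "rows_diagram n' lam \<rightarrow>\<^sub>E letters n"])
     (auto simp: eo_fillings_def intro!: finite_PiE)

lemma eo_tableaux_eq:
  assumes "diagram lam = D"
  shows "eo_tableaux n lam = eo_fillings n D"
proof -
  have column: "(\<forall>i i' j. (i, j) \<in> D \<and> (i', j) \<in> D \<and> i \<le> i' \<longrightarrow> T (i, j) \<le> T (i', j)) \<and>
     (\<forall>i i' j. (i, j) \<in> D \<and> (i', j) \<in> D \<and> i \<noteq> i' \<longrightarrow> T (i, j) \<noteq> T (i', j)) \<longleftrightarrow>
     (\<forall>i i' j. (i, j) \<in> D \<and> (i', j) \<in> D \<and> i < i' \<longrightarrow> T (i, j) < T (i', j))"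
    (is "?A \<and> ?B \<longleftrightarrow> ?C") for T :: "nat \<times> nat \<Rightarrow> letter"
  proof
    assume "?A \<and> ?B"
    then show ?C by (simp add: order.strict_iff_order)
  next
    assume C: ?C
    have ?A
    proof (intro allI impI)
      fix i i' j assume "(i, j) \<in> D \<and> (i', j) \<in> D \<and> i \<le> i'"
      then show "T (i, j) \<le> T (i', j)" using C by (cases "i = i'") (auto simp: less_imp_le)
    qed
    moreover have ?B
    proof (intro allI impI)
      fix i i' j assume "(i, j) \<in> D \<and> (i', j) \<in> D \<and> i \<noteq> i'"
      then have "T (i, j) < T (i', j) \<or> T (i', j) < T (i, j)"
        using C by (cases i i' rule: linorder_cases) auto
      then show "T (i, j) \<noteq> T (i', j)" by auto
    qed
    ultimately show "?A \<and> ?B" ..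
  qed
  have lower: "(\<forall>i j k. (i, j) \<in> D \<and> (T (i, j) = Unbarred k \<or> T (i, j) = Barred k) \<longrightarrow> i \<le> k)
     \<longleftrightarrow> (\<forall>i j. (i, j) \<in> D \<longrightarrow> Unbarred i \<le> T (i, j))" (is "?A \<longleftrightarrow> ?B")
    for T :: "nat \<times> nat \<Rightarrow> letter"
  proof
    assume A: ?A
    show ?B
    proof (intro allI impI)
      fix i j assume "(i, j) \<in> D"
      then show "Unbarred i \<le> T (i, j)" using A by (cases "T (i, j)") auto
    qed
  next
    assume B: ?B
    show ?A
    proof (intro allI impI)
      fix i j k assume "(i, j) \<in> D \<and> (T (i, j) = Unbarred k \<or> T (i, j) = Barred k)"
      then show "i \<le> k" using B[rule_format, of i j] by auto
    qed
  qed
  show ?thesis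
    unfolding eo_tableaux_def eo_fillings_def assms column[symmetric] lower[symmetric]
    by (simp only: conj_assoc)
qed

text \<open>
  With \<open>n = k + 1\<close>, \<open>M i\<close> counts the letters of row \<open>i\<close> that are smaller than \<open>Unbarred n\<close>,
  and \<open>N i\<close> those that are at most \<open>Unbarred n\<close>. The last clause is the condition on row \<open>n\<close>:
  if it contains both letters, then the first \<open>Barred n\<close> lies below an \<open>Unbarred n\<close>.
\<close>
definition interlacing :: "nat \<Rightarrow> (nat \<Rightarrow> nat) \<Rightarrow> (nat \<Rightarrow> nat) \<Rightarrow> (nat \<Rightarrow> nat) \<Rightarrow> bool" where
  "interlacing k lam M N \<longleftrightarrow>
     (\<forall>i. 1 \<le> i \<and> i \<le> Suc k \<longrightarrow> M i \<le> N i \<and> N i \<le> lam i) \<and>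
     (\<forall>i. 1 \<le> i \<and> i \<le> k \<longrightarrow> N (Suc i) \<le> M i \<and> lam (Suc i) \<le> N i) \<and>
     M (Suc k) = 0 \<and>
     (N (Suc k) = 0 \<or> N (Suc k) = lam (Suc k) \<or> 1 \<le> k \<and> M k = N (Suc k))"

definition glue :: "nat \<Rightarrow> (nat \<Rightarrow> nat) \<Rightarrow> (nat \<Rightarrow> nat) \<Rightarrow> (nat \<Rightarrow> nat) \<Rightarrow> (nat \<times> nat \<Rightarrow> letter) \<Rightarrow>
    nat \<times> nat \<Rightarrow> letter" where
  "glue k lam M N T = (\<lambda>(i, j)\<in>rows_diagram (Suc k) lam.
     if j \<le> M i then T (i, j) else if j \<le> N i then Unbarred (Suc k) else Barred (Suc k))"

lemma glue_apply:
  "(i, j) \<in> rows_diagram (Suc k) lam \<Longrightarrow> glue k lam M N T (i, j) =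
    (if j \<le> M i then T (i, j) else if j \<le> N i then Unbarred (Suc k) else Barred (Suc k))"
  by (simp add: glue_def)

definition small_cut :: "nat \<Rightarrow> (nat \<Rightarrow> nat) \<Rightarrow> (nat \<times> nat \<Rightarrow> letter) \<Rightarrow> nat \<Rightarrow> nat" where
  "small_cut n lam T i = card {j \<in> {1..lam i}. T (i, j) < Unbarred n}"

definition unbarred_cut :: "nat \<Rightarrow> (nat \<Rightarrow> nat) \<Rightarrow> (nat \<times> nat \<Rightarrow> letter) \<Rightarrow> nat \<Rightarrow> nat" where
  "unbarred_cut n lam T i = card {j \<in> {1..lam i}. T (i, j) \<le> Unbarred n}"

lemma initial_segment:
  assumes "finite S" "\<And>i. i \<in> S \<Longrightarrow> 1 \<le> i" "\<And>i j. i \<in> S \<Longrightarrow> 1 \<le> j \<Longrightarrow> j \<le> i \<Longrightarrow> j \<in> S"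
  shows "S = {1..card S}"
proof (cases "S = {}")
  case False
  have "S = {1..Max S}"
  proof (intro equalityI subsetI)
    show "i \<in> {1..Max S}" if "i \<in> S" for i
      using that assms(2) Max_ge[OF assms(1)] by simp
    show "i \<in> S" if "i \<in> {1..Max S}" for i
      using that assms(3)[OF Max_in[OF assms(1) False]] by simp
  qed
  then show ?thesis by (metis card_atLeastAtMost diff_Suc_1)
qed simp

context
  fixes k :: nat and lam M N :: "nat \<Rightarrow> nat"
  assumes decr: "\<forall>i. 1 \<le> i \<and> i \<le> k \<longrightarrow> lam (Suc i) \<le> lam i"
begin

lemma decreasing: "1 \<le> i \<Longrightarrow> i \<le> k \<Longrightarrow> lam (Suc i) \<le> lam i"
  using decr by blast

lemma decreasing_le: "1 \<le> i \<Longrightarrow> i \<le> i' \<Longrightarrow> i' \<le> Suc k \<Longrightarrow> lam i' \<le> lam i"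
proof -
  assume "1 \<le> i" "i \<le> i'" "i' \<le> Suc k"
  from this(2,1,3) show "lam i' \<le> lam i"
  proof (induction i' rule: dec_induct)
    case (step n)
    then show ?case using decreasing[of n] by simp
  qed simp
qed

lemma interlacing_le:
  assumes "interlacing k lam M N" "1 \<le> i" "i < i'" "i' \<le> Suc k"
  shows "M i' \<le> M i" "N i' \<le> M i" "lam i' \<le> N i"
proof -
  have adjacent: "M (Suc i) \<le> M i" if "1 \<le> i" "i \<le> k" for i
    using assms(1) that unfolding interlacing_def by (meson Suc_le_mono le_SucI le_trans order_refl not_less_eq_eq le_Suc_eq)
  have mono: "M j \<le> M i" if "1 \<le> i" "i \<le> j" "j \<le> Suc k" for i j
    using that(2,1,3)
  proof (induction j rule: dec_induct)
    case (step n)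
    then show ?case using adjacent[of n] by simp
  qed simp
  obtain j where j: "i' = Suc j" using assms(3) by (cases i') auto
  then have ij: "i \<le> j" "j \<le> k" "1 \<le> j" using assms by auto
  show "M i' \<le> M i" using mono assms by simp
  have "N i' \<le> M j" "lam (Suc i) \<le> N i"
    using assms ij unfolding interlacing_def j by auto
  moreover have "lam i' \<le> lam (Suc i)" using decreasing_le assms by simp
  ultimately show "N i' \<le> M i" "lam i' \<le> N i" using mono[of i j] ij assms by auto
qed

context
  fixes T :: "nat \<times> nat \<Rightarrow> letter"
  assumes inter: "interlacing k lam M N" and T: "T \<in> eo_fillings k (rows_diagram k M)"
begin

lemma inner_box:
  assumes "(i, j) \<in> rows_diagram (Suc k) lam" "j \<le> M i"
  shows "(i, j) \<in> rows_diagram k M"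
  using assms inter unfolding interlacing_def by (cases "i = Suc k") auto

lemma inner_letter:
  assumes "(i, j) \<in> rows_diagram k M"
  shows "T (i, j) \<in> letters k" "T (i, j) < Unbarred (Suc k)" "T (i, j) < Barred (Suc k)"
proof -
  show l: "T (i, j) \<in> letters k"
    using T assms unfolding eo_fillings_def by (auto simp: PiE_iff)
  then show "T (i, j) < Unbarred (Suc k)" by (rule letters_less) simp
  then show "T (i, j) < Barred (Suc k)"
    by (rule order.strict_trans) simp
qed

lemma outer_box:
  assumes "(i, j) \<in> rows_diagram k M"
  shows "(i, j) \<in> rows_diagram (Suc k) lam"
proof -
  have "M i \<le> lam i" if "1 \<le> i" "i \<le> k" for i
    using inter that unfolding interlacing_def by (metis le_SucI le_trans)
  then show ?thesis using assms by fastforce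
qed

lemma glue_inner: "(i, j) \<in> rows_diagram k M \<Longrightarrow> glue k lam M N T (i, j) = T (i, j)"
  using outer_box[of i j] by (simp add: glue_apply)

lemma glue_less_iff:
  assumes "(i, j) \<in> rows_diagram (Suc k) lam"
  shows "glue k lam M N T (i, j) < Unbarred (Suc k) \<longleftrightarrow> j \<le> M i"
    and "glue k lam M N T (i, j) \<le> Unbarred (Suc k) \<longleftrightarrow> j \<le> N i"
proof -
  have "M i \<le> N i" using inter assms unfolding interlacing_def by simp
  then show "glue k lam M N T (i, j) < Unbarred (Suc k) \<longleftrightarrow> j \<le> M i"
    and "glue k lam M N T (i, j) \<le> Unbarred (Suc k) \<longleftrightarrow> j \<le> N i"
    unfolding glue_apply[OF assms] using inner_letter[OF inner_box[OF assms]]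
    by (auto simp: less_imp_le)
qed

lemma small_cut_glue: "1 \<le> i \<Longrightarrow> i \<le> Suc k \<Longrightarrow> small_cut (Suc k) lam (glue k lam M N T) i = M i"
  and unbarred_cut_glue: "1 \<le> i \<Longrightarrow> i \<le> Suc k \<Longrightarrow> unbarred_cut (Suc k) lam (glue k lam M N T) i = N i"
proof -
  assume i: "1 \<le> i" "i \<le> Suc k"
  then have le: "M i \<le> N i" "N i \<le> lam i" using inter unfolding interlacing_def by auto
  have "{j \<in> {1..lam i}. glue k lam M N T (i, j) < Unbarred (Suc k)} = {1..M i}"
    using glue_less_iff(1)[of i] i le by auto
  then show "small_cut (Suc k) lam (glue k lam M N T) i = M i" by (simp add: small_cut_def)
  have "{j \<in> {1..lam i}. glue k lam M N T (i, j) \<le> Unbarred (Suc k)} = {1..N i}"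
    using glue_less_iff(2)[of i] i le by auto
  then show "unbarred_cut (Suc k) lam (glue k lam M N T) i = N i" by (simp add: unbarred_cut_def)
qed

lemma restrict_glue: "restrict (glue k lam M N T) (rows_diagram k M) = T"
proof
  fix b :: "nat \<times> nat"
  obtain i j where b: "b = (i, j)" by force
  show "restrict (glue k lam M N T) (rows_diagram k M) b = T b"
  proof (cases "b \<in> rows_diagram k M")
    case True
    then show ?thesis by (simp add: b glue_inner del: mem_rows_diagram)
  next
    case False
    then show ?thesis using PiE_arb[OF eo_fillings_PiE[OF T]] by simp
  qed
qed

lemma glue_in_eo_fillings: "glue k lam M N T \<in> eo_fillings (Suc k) (rows_diagram (Suc k) lam)"
proof -
  let ?D = "rows_diagram (Suc k) lam" and ?E = "rows_diagram k M" and ?G = "glue k lam M N T"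
  have ext: "?G \<in> ?D \<rightarrow>\<^sub>E letters (Suc k)"
  proof (rule PiE_I)
    fix b assume b: "b \<in> ?D"
    obtain i j where ij: "b = (i, j)" by force
    show "?G b \<in> letters (Suc k)"
      using b inner_letter(1)[OF inner_box[of i j]] unfolding ij
      by (auto simp: glue_apply letters_Suc)
  qed (auto simp: glue_def)
  have row: "?G (i, j) \<le> ?G (i, j')" if "(i, j) \<in> ?D" "(i, j') \<in> ?D" "j \<le> j'" for i j j'
  proof (cases "j' \<le> M i")
    case True
    then show ?thesis
      using that eo_fillings_row[OF T inner_box inner_box, of i j j'] by (simp add: glue_apply)
  next
    case False
    then show ?thesis
      using that inner_letter(2,3)[OF inner_box[OF that(1)]] by (auto simp: glue_apply less_imp_le)
  qed
  have col: "?G (i, j) < ?G (i', j)" if D: "(i, j) \<in> ?D" "(i', j) \<in> ?D" and i: "i < i'" for i i' j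
  proof -
    have "1 \<le> i" "i' \<le> Suc k" using D by auto
    note le = interlacing_le[OF inter this(1) i this(2)]
    consider "j \<le> M i'" | "\<not> j \<le> M i'" "j \<le> N i'" | "\<not> j \<le> M i'" "\<not> j \<le> N i'" by blast
    then show ?thesis
    proof cases
      case 1
      then have "j \<le> M i" using le by simp
      then show ?thesis
        using 1 eo_fillings_column[OF T inner_box[OF D(1)] inner_box[OF D(2)] i]
        unfolding glue_apply[OF D(1)] glue_apply[OF D(2)] by simp
    next
      case 2
      then have "j \<le> M i" using le by simp
      then show ?thesis
        using 2 inner_letter[OF inner_box[OF D(1)]] unfolding glue_apply[OF D(1)] glue_apply[OF D(2)]
        by auto
    next
      case 3
      moreover have "j \<le> N i" using le D by simp
      ultimately show ?thesis
        using inner_letter[OF inner_box[OF D(1)]] unfolding glue_apply[OF D(1)] glue_apply[OF D(2)]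
        by auto
    qed
  qed
  have low: "Unbarred i \<le> ?G (i, j)" if "(i, j) \<in> ?D" for i j
    using that eo_fillings_lower[OF T inner_box[OF that]] unfolding glue_apply[OF that] by auto
  have eo: "(c - 1, j') \<in> ?D \<and> ?G (c - 1, j') = Unbarred c"
    if D: "(c, j) \<in> ?D" "(c, j') \<in> ?D" and G: "?G (c, j) = Unbarred c" "?G (c, j') = Barred c" for c j j'
  proof (cases "c = Suc k")
    case True
    have "M c = 0" using inter True by (simp add: interlacing_def)
    then have j: "j \<le> N c" "N c < j'"
      using G glue_less_iff(2)[OF D(1)] glue_less_iff(2)[OF D(2)] True by auto
    then have k: "1 \<le> k" "M k = N c"
      using inter D unfolding interlacing_def True by auto
    then have "lam c \<le> N k" "N k \<le> lam k" using inter unfolding interlacing_def True by auto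
    then show ?thesis using j k D True by (auto simp: glue_apply)
  next
    case False
    then have "c \<le> k" using D by simp
    then have M: "j \<le> M c" "j' \<le> M c"
      using G \<open>c \<le> k\<close> glue_less_iff(1)[OF D(1)] glue_less_iff(1)[OF D(2)] by auto
    then have "T (c, j) = Unbarred c" "T (c, j') = Barred c"
      using G unfolding glue_apply[OF D(1)] glue_apply[OF D(2)] by auto
    then have *: "(c - 1, j') \<in> ?E" "T (c - 1, j') = Unbarred c"
      using eo_fillings_above[OF T inner_box[OF D(1) M(1)] _ inner_box[OF D(2) M(2)]] by blast+
    then show ?thesis using outer_box glue_inner by metis
  qed
  show ?thesis
    unfolding eo_fillings_def mem_Collect_eq
    using ext row col low eo by (intro conjI) (blast+)
qed

lemma zetas_glue:
  "zetas (rows_diagram (Suc k) lam) (glue k lam M N T) = zetas (rows_diagram k M) T \<union>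
     (if 1 \<le> k \<and> M k = 0 \<and> 0 < lam (Suc k) \<and> N (Suc k) = 0 then {Suc k} else {})"
  (is "?L = ?R")
proof (intro equalityI subsetI)
  let ?D = "rows_diagram (Suc k) lam" and ?G = "glue k lam M N T"
  fix c assume "c \<in> ?L"
  then have D: "(c - 1, 1) \<in> ?D" "(c, 1) \<in> ?D" and G: "?G (c - 1, 1) = Unbarred c" "?G (c, 1) = Barred c"
    by (auto simp: zetas_def)
  show "c \<in> ?R"
  proof (cases "c = Suc k")
    case True
    then show ?thesis
      using D G glue_less_iff[OF D(1)] glue_less_iff[OF D(2)] by auto
  next
    case False
    then have "c \<le> k" using D by simp
    then have M: "1 \<le> M (c - 1)" "1 \<le> M c"
      using G \<open>c \<le> k\<close> glue_less_iff(1)[OF D(1)] glue_less_iff(1)[OF D(2)] by auto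
    then show ?thesis
      using G inner_box[OF D(1)] inner_box[OF D(2)] unfolding glue_apply[OF D(1)] glue_apply[OF D(2)]
      by (auto simp: zetas_def)
  qed
next
  let ?D = "rows_diagram (Suc k) lam" and ?G = "glue k lam M N T"
  fix c assume "c \<in> ?R"
  then consider "c \<in> zetas (rows_diagram k M) T"
    | "c = Suc k" "1 \<le> k" "M k = 0" "0 < lam c" "N c = 0" by (auto split: if_splits)
  then show "c \<in> ?L"
  proof cases
    case 1
    then show ?thesis
      using outer_box glue_inner by (simp add: zetas_def del: mem_rows_diagram)
  next
    case 2
    then have "lam c \<le> N k" "N k \<le> lam k" "M c = 0"
      using inter unfolding interlacing_def by auto
    then show ?thesis using 2 by (auto simp: zetas_def glue_apply)
  qed
qed

lemma bars_glue:
  "bars (rows_diagram (Suc k) lam) (glue k lam M N T) = bars (rows_diagram k M) T \<union>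
     (if 0 < lam (Suc k) \<and> N (Suc k) = 0 then {Suc k} else {})"
  (is "?L = ?R")
proof (intro equalityI subsetI)
  let ?D = "rows_diagram (Suc k) lam" and ?G = "glue k lam M N T"
  fix c assume "c \<in> ?L"
  then have D: "(c, 1) \<in> ?D" and G: "?G (c, 1) = Barred c"
    by (auto simp: bars_def)
  show "c \<in> ?R"
  proof (cases "c = Suc k")
    case True
    then show ?thesis
      using D G glue_less_iff[OF D] by auto
  next
    case False
    then have "c \<le> k" using D by simp
    then have "1 \<le> M c"
      using G \<open>c \<le> k\<close> glue_less_iff(1)[OF D] by auto
    then show ?thesis
      using G inner_box[OF D] unfolding glue_apply[OF D]
      by (auto simp: bars_def)
  qed
next
  let ?D = "rows_diagram (Suc k) lam" and ?G = "glue k lam M N T"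
  fix c assume "c \<in> ?R"
  then consider "c \<in> bars (rows_diagram k M) T"
    | "c = Suc k" "0 < lam c" "N c = 0" by (auto split: if_splits)
  then show "c \<in> ?L"
  proof cases
    case 1
    then show ?thesis
      using outer_box glue_inner by (simp add: bars_def del: mem_rows_diagram)
  next
    case 2
    then have "M c = 0"
      using inter unfolding interlacing_def by auto
    then show ?thesis using 2 by (auto simp: bars_def glue_apply)
  qed
qed

end

context
  fixes T :: "nat \<times> nat \<Rightarrow> letter"
  assumes T: "T \<in> eo_fillings (Suc k) (rows_diagram (Suc k) lam)"
begin

lemma cut_iff:
  assumes "(i, j) \<in> rows_diagram (Suc k) lam"
  shows "T (i, j) < Unbarred (Suc k) \<longleftrightarrow> j \<le> small_cut (Suc k) lam T i"
    and "T (i, j) \<le> Unbarred (Suc k) \<longleftrightarrow> j \<le> unbarred_cut (Suc k) lam T i"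
proof -
  have down: "T (i, l') \<le> T (i, l)" if "l \<in> {1..lam i}" "1 \<le> l'" "l' \<le> l" for l l'
    using that assms by (intro eo_fillings_row[OF T]) auto
  have "{j \<in> {1..lam i}. T (i, j) < Unbarred (Suc k)} = {1..small_cut (Suc k) lam T i}"
    unfolding small_cut_def
  proof (rule initial_segment)
    show "j' \<in> {j \<in> {1..lam i}. T (i, j) < Unbarred (Suc k)}"
      if "j \<in> {j \<in> {1..lam i}. T (i, j) < Unbarred (Suc k)}" "1 \<le> j'" "j' \<le> j" for j j'
      using that down[of j j'] by auto
  qed auto
  then show "T (i, j) < Unbarred (Suc k) \<longleftrightarrow> j \<le> small_cut (Suc k) lam T i"
    using assms by (auto simp: set_eq_iff)
  have "{j \<in> {1..lam i}. T (i, j) \<le> Unbarred (Suc k)} = {1..unbarred_cut (Suc k) lam T i}"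
    unfolding unbarred_cut_def
  proof (rule initial_segment)
    show "j' \<in> {j \<in> {1..lam i}. T (i, j) \<le> Unbarred (Suc k)}"
      if "j \<in> {j \<in> {1..lam i}. T (i, j) \<le> Unbarred (Suc k)}" "1 \<le> j'" "j' \<le> j" for j j'
      using that down[of j j'] by auto
  qed auto
  then show "T (i, j) \<le> Unbarred (Suc k) \<longleftrightarrow> j \<le> unbarred_cut (Suc k) lam T i"
    using assms by (auto simp: set_eq_iff)
qed

lemma cut_le:
  "small_cut (Suc k) lam T i \<le> unbarred_cut (Suc k) lam T i" "unbarred_cut (Suc k) lam T i \<le> lam i"
proof -
  show "small_cut (Suc k) lam T i \<le> unbarred_cut (Suc k) lam T i"
    unfolding small_cut_def unbarred_cut_def by (rule card_mono) (auto simp: less_imp_le)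
  have "unbarred_cut (Suc k) lam T i \<le> card {1..lam i}"
    unfolding unbarred_cut_def by (rule card_mono) auto
  then show "unbarred_cut (Suc k) lam T i \<le> lam i" by simp
qed

lemma letter_T: "(i, j) \<in> rows_diagram (Suc k) lam \<Longrightarrow> T (i, j) \<in> letters (Suc k)"
  using eo_fillings_PiE[OF T] by (rule PiE_mem)

lemma interlacing_cuts: "interlacing k lam (small_cut (Suc k) lam T) (unbarred_cut (Suc k) lam T)"
proof -
  let ?M = "small_cut (Suc k) lam T" and ?N = "unbarred_cut (Suc k) lam T"
  have strict: "T (i, j) < T (Suc i, j)" if "1 \<le> i" "i \<le> k" "(Suc i, j) \<in> rows_diagram (Suc k) lam" for i j
    using that decreasing[of i] by (intro eo_fillings_column[OF T]) auto
  have "?N (Suc i) \<le> ?M i" if i: "1 \<le> i" "i \<le> k" for i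
  proof (cases "?N (Suc i) = 0")
    case False
    let ?j = "?N (Suc i)"
    have D: "(Suc i, ?j) \<in> rows_diagram (Suc k) lam" using False i cut_le(2)[of "Suc i"] by simp
    then have D': "(i, ?j) \<in> rows_diagram (Suc k) lam" using decreasing[of i] i by auto
    have "T (i, ?j) < Unbarred (Suc k)"
      using strict[OF i D] cut_iff(2)[OF D] by simp
    then show ?thesis using cut_iff(1)[OF D'] by simp
  qed simp
  moreover have "lam (Suc i) \<le> ?N i" if i: "1 \<le> i" "i \<le> k" for i
  proof (cases "lam (Suc i) = 0")
    case False
    let ?j = "lam (Suc i)"
    have D: "(Suc i, ?j) \<in> rows_diagram (Suc k) lam" using False i by simp
    then have D': "(i, ?j) \<in> rows_diagram (Suc k) lam" using decreasing[of i] i by auto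
    have "T (i, ?j) \<noteq> Barred (Suc k)"
      using strict[OF i D] letter_T[OF D] by (auto simp: letters_def)
    then have "T (i, ?j) \<le> Unbarred (Suc k)"
      using letter_T[OF D'] by (auto simp: letters_def)
    then show ?thesis using cut_iff(2)[OF D'] by simp
  qed simp
  moreover have "?M (Suc k) = 0"
  proof (rule ccontr)
    assume "?M (Suc k) \<noteq> 0"
    then have D: "(Suc k, 1) \<in> rows_diagram (Suc k) lam" "T (Suc k, 1) < Unbarred (Suc k)"
      using cut_le[of "Suc k"] cut_iff(1)[of "Suc k" 1] by auto
    then show False using eo_fillings_lower[OF T D(1)] by simp
  qed
  moreover have "1 \<le> k \<and> ?M k = ?N (Suc k)" if N: "?N (Suc k) \<noteq> 0" "?N (Suc k) \<noteq> lam (Suc k)"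
  proof -
    let ?p = "?N (Suc k)"
    have p: "1 \<le> ?p" "?p < lam (Suc k)" using N cut_le(2)[of "Suc k"] by auto
    then have D: "(Suc k, ?p) \<in> rows_diagram (Suc k) lam" "(Suc k, Suc ?p) \<in> rows_diagram (Suc k) lam"
      by auto
    have "T (Suc k, ?p) = Unbarred (Suc k)"
      using cut_iff(2)[OF D(1)] eo_fillings_lower[OF T D(1)] by auto
    moreover have "T (Suc k, Suc ?p) = Barred (Suc k)"
      using cut_iff(2)[OF D(2)] letter_T[OF D(2)] by (auto simp: letters_def)
    ultimately have "(k, Suc ?p) \<in> rows_diagram (Suc k) lam \<and> T (k, Suc ?p) = Unbarred (Suc k)"
      using eo_fillings_above[OF T D(1) _ D(2)] by simp
    then have "1 \<le> k" "\<not> Suc ?p \<le> ?M k"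
      using cut_iff(1)[of k "Suc ?p"] by auto
    moreover have "?p \<le> ?M k" using \<open>\<And>i. 1 \<le> i \<Longrightarrow> i \<le> k \<Longrightarrow> ?N (Suc i) \<le> ?M i\<close> \<open>1 \<le> k\<close> by simp
    ultimately show ?thesis by simp
  qed
  ultimately show ?thesis
    unfolding interlacing_def using cut_le by blast
qed

lemma small_box:
  assumes "(i, j) \<in> rows_diagram k (small_cut (Suc k) lam T)"
  shows "(i, j) \<in> rows_diagram (Suc k) lam" "T (i, j) < Unbarred (Suc k)"
proof -
  show D: "(i, j) \<in> rows_diagram (Suc k) lam"
    using assms cut_le[of i] by (auto intro: order_trans)
  then show "T (i, j) < Unbarred (Suc k)"
    using assms cut_iff(1)[OF D] by simp
qed

lemma restrict_in_eo_fillings: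
  "restrict T (rows_diagram k (small_cut (Suc k) lam T))
    \<in> eo_fillings k (rows_diagram k (small_cut (Suc k) lam T))"
proof -
  let ?E = "rows_diagram k (small_cut (Suc k) lam T)"
  let ?R = "restrict T ?E"
  have ext: "?R \<in> ?E \<rightarrow>\<^sub>E letters k"
  proof (rule PiE_I)
    fix b assume b: "b \<in> ?E"
    obtain i j where ij: "b = (i, j)" by force
    show "?R b \<in> letters k"
      using b less_in_letters[OF letter_T] small_box unfolding ij by (simp del: mem_rows_diagram)
  qed simp
  have row: "?R (i, j) \<le> ?R (i, j')" if "(i, j) \<in> ?E" "(i, j') \<in> ?E" "j \<le> j'" for i j j'
    using that eo_fillings_row[OF T small_box(1) small_box(1)] by (simp del: mem_rows_diagram)
  have col: "?R (i, j) < ?R (i', j)" if "(i, j) \<in> ?E" "(i', j) \<in> ?E" "i < i'" for i i' j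
    using that eo_fillings_column[OF T small_box(1) small_box(1)] by (simp del: mem_rows_diagram)
  have low: "Unbarred i \<le> ?R (i, j)" if "(i, j) \<in> ?E" for i j
    using that eo_fillings_lower[OF T small_box(1)] by (simp del: mem_rows_diagram)
  have eo: "(c - 1, j') \<in> ?E \<and> ?R (c - 1, j') = Unbarred c"
    if E: "(c, j) \<in> ?E" "(c, j') \<in> ?E" and R: "?R (c, j) = Unbarred c" "?R (c, j') = Barred c" for c j j'
  proof -
    have *: "(c - 1, j') \<in> rows_diagram (Suc k) lam" "T (c - 1, j') = Unbarred c"
      using eo_fillings_above[OF T small_box(1)[OF E(1)] _ small_box(1)[OF E(2)]] E R
      by (simp_all del: mem_rows_diagram)
    then have "T (c - 1, j') < Unbarred (Suc k)" using E by simp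
    then have "(c - 1, j') \<in> ?E"
      using cut_iff(1)[OF *(1)] * E by auto
    then show ?thesis using * by (simp del: mem_rows_diagram)
  qed
  show ?thesis
    unfolding eo_fillings_def mem_Collect_eq
    using ext row col low eo by (intro conjI) (blast+)
qed

lemma glue_restrict:
  "glue k lam (small_cut (Suc k) lam T) (unbarred_cut (Suc k) lam T)
     (restrict T (rows_diagram k (small_cut (Suc k) lam T))) = T"
    (is "glue k lam ?M ?N ?R = T")
proof
  fix b :: "nat \<times> nat"
  obtain i j where b: "b = (i, j)" by force
  show "glue k lam ?M ?N ?R b = T b"
  proof (cases "b \<in> rows_diagram (Suc k) lam")
    case True
    then have D: "(i, j) \<in> rows_diagram (Suc k) lam" by (simp add: b)
    have "i \<le> k" if "j \<le> ?M i"
    proof (rule ccontr)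
      assume "\<not> i \<le> k"
      then have "i = Suc k" using D by simp
      then have "?M i = 0" using interlacing_cuts by (simp add: interlacing_def)
      then show False using that D by simp
    qed
    then show ?thesis
      using cut_iff[OF D] letter_T[OF D] D unfolding b glue_apply[OF D]
      by (auto simp: letters_Suc dest: letters_less[of _ k "Suc k"])
  next
    case False
    then show ?thesis using PiE_arb[OF eo_fillings_PiE[OF T]] by (simp add: glue_def del: mem_rows_diagram)
  qed
qed

end

end

lemma glue_cong:
  assumes "\<And>i. 1 \<le> i \<Longrightarrow> i \<le> Suc k \<Longrightarrow> M i = M' i" "\<And>i. 1 \<le> i \<Longrightarrow> i \<le> Suc k \<Longrightarrow> N i = N' i"
  shows "glue k lam M N T = glue k lam M' N' T"
  unfolding glue_def using assms by (intro restrict_ext) auto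

definition filling_weight ::
  "nat \<Rightarrow> (nat \<Rightarrow> 'a::field) \<Rightarrow> (int \<Rightarrow> 'a) \<Rightarrow> (nat \<times> nat) set \<Rightarrow> (nat \<times> nat \<Rightarrow> letter) \<Rightarrow> 'a" where
  "filling_weight n x a D T = (\<Prod>(i, j)\<in>D. wgt n x a i j (T (i, j)))"

lemma seg_shift: "(\<Prod>j\<in>{p<..m}. y + a (int j + int c)) = seg a y (p + c) (m + c)"
  unfolding seg_def
  by (rule prod.reindex_bij_witness[where i = "\<lambda>j. j - c" and j = "\<lambda>j. j + c"]) auto

text \<open>
  The parameters are shifted because the index of \<open>a\<close> in the weight of a letter contains \<open>- n\<close>.
\<close>
lemma filling_weight_glue:
  assumes inter: "interlacing k lam M N" and T: "T \<in> eo_fillings k (rows_diagram k M)"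
  shows "filling_weight (Suc k) x a (rows_diagram (Suc k) lam) (glue k lam M N T)
    = (\<Prod>i=1..k. seg a (inverse (x (Suc k))) (Suc (N i + k - i)) (lam i + Suc k - i))
    * (\<Prod>i=1..k. seg a (x (Suc k)) (M i + k - i) (N i + k - i))
    * (seg a (x (Suc k)) 0 (N (Suc k)) * seg a (inverse (x (Suc k))) (N (Suc k)) (lam (Suc k)))
    * filling_weight k x (\<lambda>m. a (m - 1)) (rows_diagram k M) T"
proof -
  let ?t = "x (Suc k)" and ?b = "inverse (x (Suc k))" and ?a = "\<lambda>m. a (m - 1)"
  let ?w = "\<lambda>i j. wgt (Suc k) x a i j (glue k lam M N T (i, j))"
  have le: "M i \<le> N i" "N i \<le> lam i" if "1 \<le> i" "i \<le> Suc k" for i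
    using inter that unfolding interlacing_def by auto
  have row: "(\<Prod>j=1..lam i. ?w i j) = (\<Prod>j=1..M i. ?w i j) * (\<Prod>j\<in>{M i<..N i}. ?w i j) * (\<Prod>j\<in>{N i<..lam i}. ?w i j)"
    if "1 \<le> i" "i \<le> Suc k" for i
  proof -
    have "{1..lam i} = ({1..M i} \<union> {M i<..N i}) \<union> {N i<..lam i}" using le[OF that] by auto
    moreover have "prod (?w i) (({1..M i} \<union> {M i<..N i}) \<union> {N i<..lam i})
        = prod (?w i) ({1..M i} \<union> {M i<..N i}) * prod (?w i) {N i<..lam i}"
      using le[OF that] by (intro prod.union_disjoint) auto
    moreover have "prod (?w i) ({1..M i} \<union> {M i<..N i}) = prod (?w i) {1..M i} * prod (?w i) {M i<..N i}"
      by (intro prod.union_disjoint) auto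
    ultimately show ?thesis by metis
  qed
  have barred: "(\<Prod>j\<in>{N i<..lam i}. ?w i j) = seg a ?b (N i + (Suc k - i)) (lam i + (Suc k - i))"
    if "1 \<le> i" "i \<le> Suc k" for i
    unfolding seg_shift[symmetric]
  proof (rule prod.cong)
    fix j assume "j \<in> {N i<..lam i}"
    then have "glue k lam M N T (i, j) = Barred (Suc k)"
      using that le[OF that] by (subst glue_apply) auto
    then show "?w i j = ?b + a (int j + int (Suc k - i))"
      using that by (simp add: of_nat_diff algebra_simps)
  qed simp
  have unbarred: "(\<Prod>j\<in>{M i<..N i}. ?w i j)
      = (\<Prod>j\<in>{M i<..N i}. ?t + a (int j + (int k - int i + of_bool (i = Suc k))))"
    if "1 \<le> i" "i \<le> Suc k" for i
  proof (rule prod.cong)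
    fix j assume "j \<in> {M i<..N i}"
    then have "glue k lam M N T (i, j) = Unbarred (Suc k)"
      using that le[OF that] by (subst glue_apply) auto
    then show "?w i j = ?t + a (int j + (int k - int i + of_bool (i = Suc k)))"
      by (simp add: algebra_simps)
  qed simp
  have unbarred_row: "(\<Prod>j\<in>{M i<..N i}. ?w i j) = seg a ?t (M i + (k - i)) (N i + (k - i))"
    if "1 \<le> i" "i \<le> k" for i
    unfolding seg_shift[symmetric] using that by (subst unbarred) (auto simp: of_nat_diff)
  have unbarred_last: "(\<Prod>j\<in>{M (Suc k)<..N (Suc k)}. ?w (Suc k) j) = seg a ?t 0 (N (Suc k))"
    using inter by (subst unbarred) (auto simp: interlacing_def seg_def)
  have inner: "(\<Prod>j=1..M i. ?w i j) = (\<Prod>j=1..M i. wgt k x ?a i j (T (i, j)))"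
    if "1 \<le> i" "i \<le> k" for i
  proof (rule prod.cong)
    fix j assume "j \<in> {1..M i}"
    then have "glue k lam M N T (i, j) = T (i, j)"
      using that le[of i] by (subst glue_apply) auto
    then show "?w i j = wgt k x ?a i j (T (i, j))"
      by (cases "T (i, j)") (auto simp: algebra_simps)
  qed simp
  have "filling_weight (Suc k) x a (rows_diagram (Suc k) lam) (glue k lam M N T)
      = (\<Prod>i=1..Suc k. \<Prod>j=1..lam i. ?w i j)"
    unfolding filling_weight_def rows_diagram_Sigma by (rule prod.Sigma[symmetric]) auto
  also have "\<dots> = (\<Prod>i=1..k. \<Prod>j=1..lam i. ?w i j) * (\<Prod>j=1..lam (Suc k). ?w (Suc k) j)"
  proof -
    have "{1..Suc k} = insert (Suc k) {1..k}" by auto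
    then show ?thesis by (simp only: prod.insert finite_atLeastAtMost) (simp add: mult.commute)
  qed
  also have "(\<Prod>j=1..lam (Suc k). ?w (Suc k) j) = seg a ?t 0 (N (Suc k)) * seg a ?b (N (Suc k)) (lam (Suc k))"
  proof -
    have "1 \<le> Suc k" "M (Suc k) = 0" using inter by (auto simp: interlacing_def)
    then show ?thesis
      unfolding row[OF \<open>1 \<le> Suc k\<close> order_refl] unbarred_last barred[OF \<open>1 \<le> Suc k\<close> order_refl]
      by simp
  qed
  also have "(\<Prod>i=1..k. \<Prod>j=1..lam i. ?w i j)
      = (\<Prod>i=1..k. (\<Prod>j=1..M i. wgt k x ?a i j (T (i, j))) * seg a ?t (M i + k - i) (N i + k - i)
           * seg a ?b (Suc (N i + k - i)) (lam i + Suc k - i))"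
  proof (rule prod.cong)
    fix i assume "i \<in> {1..k}"
    then have i: "1 \<le> i" "i \<le> k" "i \<le> Suc k" by auto
    then have "N i + (Suc k - i) = Suc (N i + k - i)" "lam i + (Suc k - i) = lam i + Suc k - i"
      "M i + (k - i) = M i + k - i" "N i + (k - i) = N i + k - i" by auto
    then show "(\<Prod>j=1..lam i. ?w i j) = (\<Prod>j=1..M i. wgt k x ?a i j (T (i, j)))
        * seg a ?t (M i + k - i) (N i + k - i) * seg a ?b (Suc (N i + k - i)) (lam i + Suc k - i)"
      unfolding row[OF i(1,3)] inner[OF i(1,2)] unbarred_row[OF i(1,2)] barred[OF i(1,3)] by simp
  qed simp
  also have "\<dots> = filling_weight k x ?a (rows_diagram k M) T
     * (\<Prod>i=1..k. seg a ?t (M i + k - i) (N i + k - i))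
     * (\<Prod>i=1..k. seg a ?b (Suc (N i + k - i)) (lam i + Suc k - i))"
    unfolding filling_weight_def rows_diagram_Sigma by (simp add: prod.Sigma prod.distrib)
  finally show ?thesis by (simp only: mult_ac)
qed

definition filling_sum :: "'a::field \<Rightarrow> nat \<Rightarrow> (nat \<Rightarrow> 'a) \<Rightarrow> (int \<Rightarrow> 'a) \<Rightarrow> (nat \<Rightarrow> nat) \<Rightarrow> 'a" where
  "filling_sum e n x a lam = (\<Sum>T\<in>eo_fillings n (rows_diagram n lam).
     (1 + e) ^ card (zetas (rows_diagram n lam) T) * e ^ card (bars (rows_diagram n lam) T)
     * filling_weight n x a (rows_diagram n lam) T)"

definition last_row_term :: "(int \<Rightarrow> 'a::field) \<Rightarrow> 'a \<Rightarrow> 'a \<Rightarrow> nat \<Rightarrow> nat \<Rightarrow> nat \<Rightarrow> 'a" where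
  "last_row_term a e t q l p =
     (if 0 < l \<and> p = 0 then e * (if q = 0 then 1 + e else 1) else 1)
     * (seg a t 0 p * seg a (inverse t) p l)"

definition next_part :: "nat \<Rightarrow> (nat \<Rightarrow> nat) \<Rightarrow> nat \<Rightarrow> nat" where
  "next_part k N i = (if i < k then N (Suc i) else 0)"

lemma finite_zetas: "finite (zetas (rows_diagram n lam) T)"
  by (rule finite_subset[of _ "{1..n}"]) (auto simp: zetas_def)

lemma finite_bars: "finite (bars (rows_diagram n lam) T)"
  by (rule finite_subset[of _ "{1..n}"]) (auto simp: bars_def)

lemma filling_term_glue:
  assumes decr: "\<forall>i. 1 \<le> i \<and> i \<le> k \<longrightarrow> lam (Suc i) \<le> lam i"
    and inter: "interlacing k lam M N" and T: "T \<in> eo_fillings k (rows_diagram k M)"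
  shows "(1 + e) ^ card (zetas (rows_diagram (Suc k) lam) (glue k lam M N T))
     * e ^ card (bars (rows_diagram (Suc k) lam) (glue k lam M N T))
     * filling_weight (Suc k) x a (rows_diagram (Suc k) lam) (glue k lam M N T)
   = (\<Prod>i=1..k. seg a (inverse (x (Suc k))) (Suc (N i + k - i)) (lam i + Suc k - i))
     * (\<Prod>i=1..k. seg a (x (Suc k)) (M i + k - i) (N i + k - i))
     * last_row_term a e (x (Suc k)) (if k = 0 then lam (Suc k) else M k) (lam (Suc k)) (N (Suc k))
     * ((1 + e) ^ card (zetas (rows_diagram k M) T) * e ^ card (bars (rows_diagram k M) T)
        * filling_weight k x (\<lambda>m. a (m - 1)) (rows_diagram k M) T)"
proof -
  have "Suc k \<notin> zetas (rows_diagram k M) T" "Suc k \<notin> bars (rows_diagram k M) T"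
    by (auto simp: zetas_def bars_def)
  then have "card (zetas (rows_diagram (Suc k) lam) (glue k lam M N T)) = card (zetas (rows_diagram k M) T)
       + (if 1 \<le> k \<and> M k = 0 \<and> 0 < lam (Suc k) \<and> N (Suc k) = 0 then 1 else 0)"
    "card (bars (rows_diagram (Suc k) lam) (glue k lam M N T)) = card (bars (rows_diagram k M) T)
       + (if 0 < lam (Suc k) \<and> N (Suc k) = 0 then 1 else 0)"
    unfolding zetas_glue[OF decr inter T] bars_glue[OF decr inter T]
    using finite_zetas[of k M T] finite_bars[of k M T] by auto
  then show ?thesis
    unfolding filling_weight_glue[OF inter T] last_row_term_def by simp
qed

text \<open>In a single row there is no row above that limits the number of unbarred letters, hence \<open>q\<close>.\<close>
lemma filling_sum_Suc:
  assumes decr: "\<forall>i. 1 \<le> i \<and> i \<le> k \<longrightarrow> lam (Suc i) \<le> lam i"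
  shows "filling_sum e (Suc k) x a lam =
    (\<Sum>N\<in>(\<Pi>\<^sub>E i\<in>{1..k}. {lam (Suc i)..lam i}). \<Sum>M\<in>(\<Pi>\<^sub>E i\<in>{1..k}. {next_part k N i..N i}).
      (\<Prod>i=1..k. seg a (inverse (x (Suc k))) (Suc (N i + k - i)) (lam i + Suc k - i))
      * (\<Prod>i=1..k. seg a (x (Suc k)) (M i + k - i) (N i + k - i))
      * (let q = if k = 0 then lam (Suc k) else M k; l = lam (Suc k) in
          \<Sum>p\<in>{0, min q l}. last_row_term a e (x (Suc k)) q l p)
      * filling_sum e k x (\<lambda>m. a (m - 1)) M)"
    (is "_ = ?rhs")
proof -
  define q where "q M = (if k = 0 then lam (Suc k) else M k)" for M :: "nat \<Rightarrow> nat"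
  let ?l = "lam (Suc k)"
  let ?NN = "\<Pi>\<^sub>E i\<in>{1..k}. {lam (Suc i)..lam i}"
  let ?MM = "\<lambda>N. \<Pi>\<^sub>E i\<in>{1..k}. {next_part k N i..N i}"
  let ?PT = "\<lambda>M. {0, min (q M) ?l} \<times> eo_fillings k (rows_diagram k M)"
  let ?S = "SIGMA N:?NN. SIGMA M:?MM N. ?PT M"
  let ?g = "\<lambda>(N, M, p, T). (\<Prod>i=1..k. seg a (inverse (x (Suc k))) (Suc (N i + k - i)) (lam i + Suc k - i))
      * (\<Prod>i=1..k. seg a (x (Suc k)) (M i + k - i) (N i + k - i))
      * last_row_term a e (x (Suc k)) (q M) ?l p
      * ((1 + e) ^ card (zetas (rows_diagram k M) T) * e ^ card (bars (rows_diagram k M) T)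
        * filling_weight k x (\<lambda>m. a (m - 1)) (rows_diagram k M) T)"
  let ?m = "small_cut (Suc k) lam" and ?n = "unbarred_cut (Suc k) lam"
  let ?join = "\<lambda>(N, M, p, T). glue k lam (M(Suc k := 0)) (N(Suc k := p)) T"
  let ?split = "\<lambda>T. (restrict (?n T) {1..k}, restrict (?m T) {1..k}, ?n T (Suc k),
      restrict T (rows_diagram k (?m T)))"
  have valid: "interlacing k lam (M(Suc k := 0)) (N(Suc k := p))"
    if "N \<in> ?NN" "M \<in> ?MM N" "p \<in> {0, min (q M) ?l}" for N M p
  proof -
    have N: "lam (Suc i) \<le> N i" "N i \<le> lam i" and M: "next_part k N i \<le> M i" "M i \<le> N i"
      if "1 \<le> i" "i \<le> k" for i
      using that \<open>N \<in> ?NN\<close> \<open>M \<in> ?MM N\<close> PiE_mem[of _ "{1..k}"] by force+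
    have next_le: "N (Suc i) \<le> M i" if "1 \<le> i" "i \<le> k" "i \<noteq> k" for i
      using M(1)[of i] that by (simp add: next_part_def)
    show ?thesis
      unfolding interlacing_def using N M(2) next_le that(3)
      by (auto simp: le_Suc_eq q_def min_def split: if_splits)
  qed
  have same: "rows_diagram k (M(Suc k := 0)) = rows_diagram k M" for M
    by (rule rows_diagram_cong) auto
  have "sum ?g ?S = filling_sum e (Suc k) x a lam"
    unfolding filling_sum_def
  proof (rule sum.reindex_bij_witness[where i = ?split and j = ?join])
    fix b assume "b \<in> ?S"
    then obtain N M p T where b: "b = (N, M, p, T)" and N: "N \<in> ?NN" and M: "M \<in> ?MM N"
      and p: "p \<in> {0, min (q M) ?l}" and T: "T \<in> eo_fillings k (rows_diagram k M)" by blast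
    note v = valid[OF N M p]
    have T': "T \<in> eo_fillings k (rows_diagram k (M(Suc k := 0)))" by (simp add: same T)
    note cuts = small_cut_glue[OF decr v T'] unbarred_cut_glue[OF decr v T']
    have "restrict (?n (?join b)) {1..k} = N"
      using PiE_arb[OF N] cuts(2) by (auto simp: b restrict_def)
    moreover have mM: "restrict (?m (?join b)) {1..k} = M"
      using PiE_arb[OF M] cuts(1) by (auto simp: b restrict_def)
    moreover have "restrict (?join b) (rows_diagram k (?m (?join b))) = T"
    proof -
      have "rows_diagram k (?m (?join b)) = rows_diagram k (M(Suc k := 0))"
        by (rule rows_diagram_cong) (use cuts(1) in \<open>auto simp: b\<close>)
      then show ?thesis using restrict_glue[OF decr v T'] by (simp add: b)
    qed
    ultimately show "?split (?join b) = b" using cuts(2)[of "Suc k"] by (simp add: b)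
    show "?join b \<in> eo_fillings (Suc k) (rows_diagram (Suc k) lam)"
      using glue_in_eo_fillings[OF decr v T'] by (simp add: b)
    have "(\<Prod>i=1..k. seg a (inverse (x (Suc k))) (Suc ((N(Suc k := p)) i + k - i)) (lam i + Suc k - i))
        = (\<Prod>i=1..k. seg a (inverse (x (Suc k))) (Suc (N i + k - i)) (lam i + Suc k - i))"
      "(\<Prod>i=1..k. seg a (x (Suc k)) ((M(Suc k := 0)) i + k - i) ((N(Suc k := p)) i + k - i))
        = (\<Prod>i=1..k. seg a (x (Suc k)) (M i + k - i) (N i + k - i))"
      by (auto intro!: prod.cong)
    then show "(1 + e) ^ card (zetas (rows_diagram (Suc k) lam) (?join b))
     * e ^ card (bars (rows_diagram (Suc k) lam) (?join b))
     * filling_weight (Suc k) x a (rows_diagram (Suc k) lam) (?join b) = ?g b"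
      using filling_term_glue[OF decr v T', of e x a] by (simp add: b same q_def)
  next
    fix T assume T: "T \<in> eo_fillings (Suc k) (rows_diagram (Suc k) lam)"
    note v = interlacing_cuts[OF decr T]
    have m0: "?m T (Suc k) = 0" using v by (simp add: interlacing_def)
    have eq: "((restrict (?m T) {1..k})(Suc k := 0)) i = ?m T i"
      "((restrict (?n T) {1..k})(Suc k := ?n T (Suc k))) i = ?n T i" if "1 \<le> i" "i \<le> Suc k" for i
      using that m0 by (auto simp: le_Suc_eq)
    have diagram: "rows_diagram k (restrict (?m T) {1..k}) = rows_diagram k (?m T)"
      by (rule rows_diagram_cong) auto
    have "?join (?split T) = glue k lam (?m T) (?n T) (restrict T (rows_diagram k (?m T)))"
      unfolding prod.case by (rule glue_cong[OF eq])
    then show "?join (?split T) = T"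
      by (simp only: glue_restrict[OF decr T])
    have "?n T (Suc k) \<in> {0, min (q (restrict (?m T) {1..k})) ?l}"
    proof (cases "k = 0")
      case True
      then show ?thesis using v by (auto simp: interlacing_def q_def)
    next
      case False
      then have "?n T (Suc k) \<le> ?m T k" "?n T (Suc k) \<le> ?l" using v by (auto simp: interlacing_def)
      moreover have "?n T (Suc k) = 0 \<or> ?n T (Suc k) = ?l \<or> ?m T k = ?n T (Suc k)"
        using v by (auto simp: interlacing_def)
      ultimately show ?thesis using False by (auto simp: q_def min_def)
    qed
    moreover have "restrict (?n T) {1..k} \<in> ?NN"
      using v by (auto simp: interlacing_def)
    moreover have "restrict (?m T) {1..k} \<in> ?MM (restrict (?n T) {1..k})"
      using v by (auto simp: interlacing_def next_part_def)
    ultimately show "?split T \<in> ?S"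
      unfolding mem_Sigma_iff diagram using restrict_in_eo_fillings[OF decr T] by blast
  qed
  moreover have "sum ?g ?S = (\<Sum>N\<in>?NN. \<Sum>M\<in>?MM N. \<Sum>p\<in>{0, min (q M) ?l}. \<Sum>T\<in>eo_fillings k (rows_diagram k M). ?g (N, M, p, T))"
    by (subst sum.Sigma[symmetric], simp_all add: finite_PiE)+
  moreover have "\<dots> = ?rhs"
    by (simp only: filling_sum_def q_def Let_def sum_distrib_left sum_distrib_right split)
       (rule sum.cong[OF refl], rule sum.cong[OF refl], rule sum.swap)
  ultimately show ?thesis by simp
qed

subsection \<open>Branching of determinants\<close>

lemma last_row_sum:
  fixes e :: "'a::field"
  assumes "e * e = 1"
  shows "(if l = 0 then 1 + e else 1) * (\<Sum>p\<in>{0, min q l}. last_row_term a e t q l p)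
     = row_factor a e t q l"
proof (cases "min q l = 0")
  case True
  then show ?thesis
    using assms by (auto simp: last_row_term_def row_factor_def fpow_eq_seg min_def
      distrib_left distrib_right mult.assoc[symmetric] split: if_splits)
next
  case False
  then have "(\<Sum>p\<in>{0, min q l}. last_row_term a e t q l p)
      = last_row_term a e t q l 0 + last_row_term a e t q l (min q l)" by simp
  then show ?thesis
    using False by (auto simp: last_row_term_def row_factor_def fpow_eq_seg add.commute)
qed

lemma fpow_shift_Suc:
  assumes "a 0 = 0"
  shows "fpow (\<lambda>m. a (m - 1)) y (Suc p) = y * fpow a y p"
proof (induction p)
  case 0
  then show ?case by (simp add: fpow_def assms)
next
  case (Suc p)
  then show ?case by (simp add: fpow_Suc[of _ y "Suc p"] fpow_Suc[of a] mult_ac)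
qed

definition numerator :: "'a::field \<Rightarrow> nat \<Rightarrow> (nat \<Rightarrow> 'a) \<Rightarrow> (int \<Rightarrow> 'a) \<Rightarrow> (nat \<Rightarrow> nat) \<Rightarrow> 'a" where
  "numerator e n x a lam = cdet n (\<lambda>j i. pair_pow a e (x (Suc i)) (lam j + n - j))"

definition pair_vandermonde :: "nat \<Rightarrow> (nat \<Rightarrow> 'a::field) \<Rightarrow> 'a" where
  "pair_vandermonde n x = (\<Prod>j=1..n. \<Prod>i\<in>{1..<j}. x i + inverse (x i) - x j - inverse (x j))"

lemma pair_pow_shift:
  assumes "a 0 = 0"
  shows "pair_pow (\<lambda>m. a (m - 1)) e y p = (if p = 0 then (1 + e) else shift_pow a e y p)"
  by (cases p) (simp_all add: pair_pow_def shift_pow_def fpow_shift_Suc[of a, OF assms])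

text \<open>
  The terms that obstruct divisibility by \<open>z - z\<^sub>n\<close> are multiples of the last row: of the row
  itself for \<open>e = 1\<close>, and of the row divided by \<open>t - 1/t\<close> for \<open>e = - 1\<close>.
\<close>
lemma pair_pow_row_operation:
  fixes x :: "nat \<Rightarrow> 'a::field_char_0"
  assumes e: "e = 1 \<or> e = - 1" and x: "\<And>i. 1 \<le> i \<Longrightarrow> i \<le> Suc k \<Longrightarrow> x i \<noteq> 0"
  shows "cdet (Suc k) (\<lambda>j i. pair_pow a e (x (Suc i)) (L j))
    = (\<Prod>i<k. x (Suc i) + inverse (x (Suc i)) - x (Suc k) - inverse (x (Suc k)))
      * cdet (Suc k) (\<lambda>j i. if i < k then outer_sum a e (x (Suc k)) (x (Suc i)) (L j)
          else pair_pow a e (x (Suc k)) (L j))"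
proof -
  let ?t = "x (Suc k)"
  let ?d = "\<lambda>i. x (Suc i) + inverse (x (Suc i)) - ?t - inverse ?t"
  have t: "?t \<noteq> 0" using x by simp
  obtain b w c where w: "\<And>l. pair_pow a e ?t l = c * w l"
    and b: "\<And>i l. i < k \<Longrightarrow> pair_pow a e (x (Suc i)) l
      = ?d i * outer_sum a e ?t (x (Suc i)) l + b i * w l"
  proof (cases "e = 1")
    case True
    show ?thesis
    proof (rule that[where b = "\<lambda>_. 1" and w = "pair_pow a e ?t" and c = 1])
      show "pair_pow a e (x (Suc i)) l = ?d i * outer_sum a e ?t (x (Suc i)) l + 1 * pair_pow a e ?t l"
        if "i < k" for i l
        unfolding True mult_1_left
        by (rule pair_pow_decomposition_plus[OF t]) (use x that in simp)
    qed simp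
  next
    case False
    then have e: "e = - 1" using e by simp
    obtain w where "\<And>l. pair_pow a (- 1) ?t l = (?t - inverse ?t) * w l"
      and "\<And>y l. y \<noteq> 0 \<Longrightarrow> pair_pow a (- 1) y l
       = (y + inverse y - ?t - inverse ?t) * outer_sum a (- 1) ?t y l + (y - inverse y) * w l"
      using pair_pow_decomposition_minus[OF t, of a] by blast
    then show ?thesis
      by (intro that[where b = "\<lambda>i. x (Suc i) - inverse (x (Suc i))" and w = w and c = "?t - inverse ?t"])
         (use x in \<open>simp_all add: e\<close>)
  qed
  have "cdet (Suc k) (\<lambda>j i. pair_pow a e (x (Suc i)) (L j))
     = cdet (Suc k) (\<lambda>j i. if i < k then ?d i * outer_sum a e ?t (x (Suc i)) (L j) + b i * w (L j)
         else c * w (L j))"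
    using b w by (intro cdet_cong) (auto simp: less_Suc_eq)
  also have "\<dots> = (\<Prod>i<k. ?d i) * cdet (Suc k) (\<lambda>j i. if i < k then outer_sum a e ?t (x (Suc i)) (L j)
      else c * w (L j))"
    by (rule cdet_row_operation)
  also have "cdet (Suc k) (\<lambda>j i. if i < k then outer_sum a e ?t (x (Suc i)) (L j) else c * w (L j))
     = cdet (Suc k) (\<lambda>j i. if i < k then outer_sum a e ?t (x (Suc i)) (L j)
          else pair_pow a e ?t (L j))"
    by (simp only: w)
  finally show ?thesis .
qed

lemma cdet_solve_recurrence:
  fixes X Y :: "nat \<Rightarrow> nat \<Rightarrow> 'a::comm_ring_1"
  assumes rec: "\<And>i l. i < n \<Longrightarrow> X (Suc l) i = (s + a (int (Suc l))) * X l i + Y l i"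
    and r: "r < n" and L: "\<And>j. 1 \<le> j \<Longrightarrow> j \<le> r \<Longrightarrow> L (Suc j) \<le> L j"
    and v: "\<And>j. 1 \<le> j \<Longrightarrow> j \<le> Suc r \<Longrightarrow> v j = X (L j)"
  shows "cdet n v = cdet n (\<lambda>j i. if j \<le> r then \<Sum>m\<in>{L (Suc j)..<L j}. seg a s (Suc m) (L j) * Y m i
       else v j i)"
proof -
  have "cdet n v = cdet n (\<lambda>j i. if j \<le> r then v j i - seg a s (L (Suc j)) (L j) * v (Suc j) i else v j i)"
    by (rule cdet_column_operation[OF r, symmetric])
  also have "\<dots> = cdet n (\<lambda>j i. if j \<le> r then \<Sum>m\<in>{L (Suc j)..<L j}. seg a s (Suc m) (L j) * Y m i
       else v j i)"
  proof (rule cdet_cong)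
    fix j i assume j: "1 \<le> j" "j \<le> n" and i: "i < n"
    have "X (L j) i - seg a s (L (Suc j)) (L j) * X (L (Suc j)) i
        = (\<Sum>m\<in>{L (Suc j)..<L j}. seg a s (Suc m) (L j) * Y m i)" if "j \<le> r"
      using solve_recurrence[of "\<lambda>l. X l i" s a "\<lambda>l. Y l i", OF rec[OF i] L[OF j(1) that]]
      by simp
    then show "(if j \<le> r then v j i - seg a s (L (Suc j)) (L j) * v (Suc j) i else v j i)
       = (if j \<le> r then \<Sum>m\<in>{L (Suc j)..<L j}. seg a s (Suc m) (L j) * Y m i else v j i)"
      using j by (auto simp: v)
  qed
  finally show ?thesis .
qed


lemma sum_shift_interval:
  fixes f :: "nat \<Rightarrow> 'a::comm_monoid_add"
  shows "(\<Sum>m\<in>{p + c..<Suc (q + c)}. f m) = (\<Sum>m\<in>{p..q}. f (m + c))"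
  by (rule sum.reindex_bij_witness[where i = "\<lambda>m. m + c" and j = "\<lambda>m. m - c"]) auto

lemma numerator_Suc:
  fixes x :: "nat \<Rightarrow> 'a::field_char_0"
  assumes e: "e = 1 \<or> e = - 1" and x: "\<And>i. 1 \<le> i \<Longrightarrow> i \<le> Suc k \<Longrightarrow> x i \<noteq> 0"
    and k: "1 \<le> k" and decr: "\<forall>i. 1 \<le> i \<and> i \<le> k \<longrightarrow> lam (Suc i) \<le> lam i"
  shows "numerator e (Suc k) x a lam
    = (\<Prod>i<k. x (Suc i) + inverse (x (Suc i)) - x (Suc k) - inverse (x (Suc k))) *
    (\<Sum>N\<in>(\<Pi>\<^sub>E i\<in>{1..k}. {lam (Suc i)..lam i}). \<Sum>M\<in>(\<Pi>\<^sub>E i\<in>{1..k}. {next_part k N i..N i}).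
      (\<Prod>i=1..k. seg a (inverse (x (Suc k))) (Suc (N i + k - i)) (lam i + Suc k - i))
      * (\<Prod>i=1..k. seg a (x (Suc k)) (M i + k - i) (N i + k - i))
      * row_factor a e (x (Suc k)) (M k) (lam (Suc k))
      * cdet k (\<lambda>j i. shift_pow a e (x (Suc i)) (M j + k - j)))"
proof -
  let ?t = "x (Suc k)" and ?b = "inverse (x (Suc k))" and ?l = "lam (Suc k)"
  define L where "L j = lam j + Suc k - j" for j
  define X where "X l i = (if i < k then outer_sum a e ?t (x (Suc i)) l else pair_pow a e ?t l)" for l i
  define Y where "Y m i = (if i < k then inner_sum a e ?t (x (Suc i)) m else (?t - ?b) * fpow a ?t m)" for m i
  define F where "F p i = (if i < k then shift_pow a e (x (Suc i)) p else 0)" for p i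
  have X_Suc: "X (Suc l) i = (?b + a (int (Suc l))) * X l i + Y l i" for l i
    by (simp add: X_def Y_def outer_sum_Suc pair_pow_def fpow_Suc algebra_simps)
  have Y_Suc: "Y (Suc m) i = (?t + a (int (Suc m))) * Y m i + F (Suc m) i" for m i
    by (simp add: Y_def F_def inner_sum_Suc fpow_Suc algebra_simps)
  have decrL: "L (Suc j) \<le> L j" if "1 \<le> j" "j \<le> k" for j
    using that decr unfolding L_def by (meson diff_le_mono2 diff_le_mono add_le_mono order_trans le_SucI order_refl)
  have inner: "cdet (Suc k) (\<lambda>j i. if j \<in> {1..k} then Y (N j + k - j) i else X (L j) i)
     = (\<Sum>M\<in>(\<Pi>\<^sub>E i\<in>{1..k}. {next_part k N i..N i}).
        (\<Prod>i=1..k. seg a ?t (M i + k - i) (N i + k - i)) * row_factor a e ?t (M k) ?l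
        * cdet k (\<lambda>j i. shift_pow a e (x (Suc i)) (M j + k - j)))"
    (is "cdet _ ?V = _")
    if N: "N \<in> (\<Pi>\<^sub>E i\<in>{1..k}. {lam (Suc i)..lam i})" for N
  proof -
    have N_le: "lam (Suc j) \<le> N j" "N j \<le> lam j" if "1 \<le> j" "j \<le> k" for j
      using PiE_mem[OF N, of j] that by auto
    have next_le: "N (Suc j) \<le> N j" if "1 \<le> j" "j < k" for j
      using N_le(1)[of j] N_le(2)[of "Suc j"] that by simp
    let ?L = "\<lambda>j. N j + k - j"
    let ?C = "\<lambda>j i. if j \<le> k - 1 then \<Sum>m\<in>{?L (Suc j)..<?L j}. seg a ?t (Suc m) (?L j) * F (Suc m) i else ?V j i"
    let ?c = "\<lambda>j q. seg a ?t (q + k - j) (N j + k - j) * (if j = k then row_factor a e ?t q ?l else 1)"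
    have "cdet (Suc k) ?V = cdet (Suc k) ?C"
    proof (rule cdet_solve_recurrence[where X = Y])
      show "?L (Suc j) \<le> ?L j" if "1 \<le> j" "j \<le> k - 1" for j
      proof -
        have "j < k" using that k by simp
        then show ?thesis using next_le[OF that(1)] by arith
      qed
    qed (use k in \<open>auto simp: Y_Suc fun_eq_iff\<close>)
    also have "\<dots> = cdet k (\<lambda>j i. if j < k then ?C j i else ?C (Suc k) k * ?C k i - ?C k k * ?C (Suc k) i)"
      by (rule cdet_bottom_row[OF k]) (auto simp: F_def)
    also have "\<dots> = cdet k (\<lambda>j i. if j \<in> {1..k} then
        \<Sum>q\<in>{next_part k N j..N j}. ?c j q * shift_pow a e (x (Suc i)) (q + k - j) else 0)"
    proof (rule cdet_cong)
      fix j i assume j: "1 \<le> j" "j \<le> k" and i: "i < k"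
      show "(if j < k then ?C j i else ?C (Suc k) k * ?C k i - ?C k k * ?C (Suc k) i)
        = (if j \<in> {1..k} then
        \<Sum>q\<in>{next_part k N j..N j}. ?c j q * shift_pow a e (x (Suc i)) (q + k - j) else 0)"
      proof (cases "j = k")
        case True
        have "?C (Suc k) k * ?C k i - ?C k k * ?C (Suc k) i
            = pair_pow a e ?t ?l * inner_sum a e ?t (x (Suc i)) (N k)
              - (?t - ?b) * fpow a ?t (N k) * outer_sum a e ?t (x (Suc i)) ?l"
        proof -
          have "\<not> k \<le> k - 1" "\<not> Suc k \<le> k - 1" using k by arith+
          then show ?thesis using k i by (simp add: X_def Y_def L_def)
        qed
        also have "\<dots> = (\<Sum>q\<le>N k. seg a ?t q (N k) * row_factor a e ?t q ?l * shift_pow a e (x (Suc i)) q)"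
          by (rule row_factor_expansion) (use N_le(1)[OF k] in simp)
        finally show ?thesis
          using k True by (simp add: next_part_def atMost_atLeast0)
      next
        case False
        then have "j < k" using j by simp
        obtain c where c: "k = Suc (j + c)" using \<open>j < k\<close> less_imp_Suc_add by blast
        have "?C j i = (\<Sum>m\<in>{N (Suc j) + c..<Suc (N j + c)}. seg a ?t (Suc m) (?L j) * F (Suc m) i)"
          by (simp add: c)
        also have "\<dots> = (\<Sum>q\<in>{N (Suc j)..N j}. seg a ?t (Suc (q + c)) (?L j) * F (Suc (q + c)) i)"
          by (rule sum_shift_interval)
        also have "\<dots> = (\<Sum>q\<in>{N (Suc j)..N j}. seg a ?t (q + k - j) (?L j) * shift_pow a e (x (Suc i)) (q + k - j))"
          by (rule sum.cong) (use i in \<open>auto simp: F_def c\<close>)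
        finally show ?thesis
          using j \<open>j < k\<close> by (simp add: next_part_def)
      qed
    qed
    also have "\<dots> = (\<Sum>M\<in>(\<Pi>\<^sub>E i\<in>{1..k}. {next_part k N i..N i}). (\<Prod>j\<in>{1..k}. ?c j (M j))
        * cdet k (\<lambda>j i. if j \<in> {1..k} then shift_pow a e (x (Suc i)) (M j + k - j) else 0))"
      by (rule cdet_linear) auto
    also have "\<dots> = (\<Sum>M\<in>(\<Pi>\<^sub>E i\<in>{1..k}. {next_part k N i..N i}).
        (\<Prod>i=1..k. seg a ?t (M i + k - i) (N i + k - i)) * row_factor a e ?t (M k) ?l
        * cdet k (\<lambda>j i. shift_pow a e (x (Suc i)) (M j + k - j)))"
    proof (rule sum.cong)
      fix M
      have "cdet k (\<lambda>j i. if j \<in> {1..k} then shift_pow a e (x (Suc i)) (M j + k - j) else 0)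
         = cdet k (\<lambda>j i. shift_pow a e (x (Suc i)) (M j + k - j))"
        by (rule cdet_cong) auto
      moreover have "(\<Prod>j\<in>{1..k}. if j = k then row_factor a e ?t (M j) ?l else 1) = row_factor a e ?t (M k) ?l"
        using k by (simp add: prod.delta)
      ultimately show "(\<Prod>j\<in>{1..k}. ?c j (M j))
          * cdet k (\<lambda>j i. if j \<in> {1..k} then shift_pow a e (x (Suc i)) (M j + k - j) else 0)
        = (\<Prod>i=1..k. seg a ?t (M i + k - i) (N i + k - i)) * row_factor a e ?t (M k) ?l
          * cdet k (\<lambda>j i. shift_pow a e (x (Suc i)) (M j + k - j))"
        by (simp only: prod.distrib)
    qed simp
    finally show ?thesis .
  qed
  have "cdet (Suc k) (\<lambda>j i. X (L j) i)
      = cdet (Suc k) (\<lambda>j i. if j \<le> k then \<Sum>m\<in>{L (Suc j)..<L j}. seg a ?b (Suc m) (L j) * Y m i else X (L j) i)"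
    by (rule cdet_solve_recurrence[where X = X]) (use decrL X_Suc in auto)
  also have "\<dots> = cdet (Suc k) (\<lambda>j i. if j \<in> {1..k} then
      \<Sum>m\<in>{lam (Suc j)..lam j}. seg a ?b (Suc (m + k - j)) (L j) * Y (m + k - j) i else X (L j) i)"
  proof (rule cdet_cong)
    fix j i :: nat assume j: "1 \<le> j"
    have "(\<Sum>m\<in>{L (Suc j)..<L j}. seg a ?b (Suc m) (L j) * Y m i)
        = (\<Sum>m\<in>{lam (Suc j)..lam j}. seg a ?b (Suc (m + k - j)) (L j) * Y (m + k - j) i)" if "j \<le> k"
    proof -
      have "{L (Suc j)..<L j} = {lam (Suc j) + (k - j)..<Suc (lam j + (k - j))}"
        using that by (auto simp: L_def)
      then show ?thesis using that by (simp only: sum_shift_interval) simp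
    qed
    then show "(if j \<le> k then \<Sum>m\<in>{L (Suc j)..<L j}. seg a ?b (Suc m) (L j) * Y m i else X (L j) i)
      = (if j \<in> {1..k} then
      \<Sum>m\<in>{lam (Suc j)..lam j}. seg a ?b (Suc (m + k - j)) (L j) * Y (m + k - j) i else X (L j) i)"
      using j by simp
  qed
  also have "\<dots> = (\<Sum>N\<in>(\<Pi>\<^sub>E i\<in>{1..k}. {lam (Suc i)..lam i}).
      (\<Prod>i=1..k. seg a ?b (Suc (N i + k - i)) (L i))
      * cdet (Suc k) (\<lambda>j i. if j \<in> {1..k} then Y (N j + k - j) i else X (L j) i))"
    by (rule cdet_linear) auto
  also have "\<dots> = (\<Sum>N\<in>(\<Pi>\<^sub>E i\<in>{1..k}. {lam (Suc i)..lam i}). \<Sum>M\<in>(\<Pi>\<^sub>E i\<in>{1..k}. {next_part k N i..N i}).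
      (\<Prod>i=1..k. seg a ?b (Suc (N i + k - i)) (lam i + Suc k - i))
      * (\<Prod>i=1..k. seg a ?t (M i + k - i) (N i + k - i))
      * row_factor a e ?t (M k) ?l
      * cdet k (\<lambda>j i. shift_pow a e (x (Suc i)) (M j + k - j)))"
    by (rule sum.cong[OF refl], subst inner, assumption) (simp only: L_def sum_distrib_left mult.assoc)
  finally have expansion: "cdet (Suc k) (\<lambda>j i. X (L j) i) = \<dots>" .
  have "numerator e (Suc k) x a lam
    = (\<Prod>i<k. x (Suc i) + inverse (x (Suc i)) - ?t - ?b) * cdet (Suc k) (\<lambda>j i. X (L j) i)"
    unfolding numerator_def X_def L_def by (rule pair_pow_row_operation) (use e x in auto)
  then show ?thesis unfolding expansion .
qed

lemma numerator_shift:
  fixes x :: "nat \<Rightarrow> 'a::field_char_0"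
  assumes e: "e = 1 \<or> e = - 1" and a: "a 0 = 0" and k: "1 \<le> k"
  shows "numerator e k x (\<lambda>m. a (m - 1)) M
    = (if M k = 0 then 1 + e else 1) * cdet k (\<lambda>j i. shift_pow a e (x (Suc i)) (M j + k - j))"
proof -
  let ?s = "\<lambda>j i. shift_pow a e (x (Suc i)) (M j + k - j)"
  let ?c = "if M k = 0 then 1 + e else 1"
  have "numerator e k x (\<lambda>m. a (m - 1)) M = cdet k (\<lambda>j i. if j < k then ?s j i else ?c * ?s k i - 0 * ?s k i)"
    unfolding numerator_def
  proof (rule cdet_cong)
    fix j i assume "1 \<le> j" "j \<le> k"
    then show "pair_pow (\<lambda>m. a (m - 1)) e (x (Suc i)) (M j + k - j)
        = (if j < k then ?s j i else ?c * ?s k i - 0 * ?s k i)"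
      using e by (auto simp: pair_pow_shift[of a, OF a] shift_pow_def)
  qed
  also have "\<dots> = ?c * cdet k (\<lambda>j i. if j < k then ?s j i else ?s k i)"
    by (subst cdet_linear_last[OF k]) simp
  also have "cdet k (\<lambda>j i. if j < k then ?s j i else ?s k i) = cdet k ?s"
    by (rule cdet_cong) (auto simp: le_less)
  finally show ?thesis .
qed

lemma pair_vandermonde_Suc:
  "pair_vandermonde (Suc k) x = pair_vandermonde k x
     * (\<Prod>i<k. x (Suc i) + inverse (x (Suc i)) - x (Suc k) - inverse (x (Suc k)))"
proof -
  have insert: "{1..Suc k} = insert (Suc k) {1..k}" by auto
  have shift: "(\<Prod>i\<in>{1..<Suc k}. g i) = (\<Prod>i<k. g (Suc i))" for g :: "nat \<Rightarrow> 'a"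
    unfolding One_nat_def atLeastLessThanSuc_atLeastAtMost by (rule prod.atLeast1_atMost_eq)
  have "pair_vandermonde (Suc k) x
      = (\<Prod>i\<in>{1..<Suc k}. x i + inverse (x i) - x (Suc k) - inverse (x (Suc k))) * pair_vandermonde k x"
    unfolding pair_vandermonde_def insert by (rule prod.insert) auto
  then show ?thesis
    unfolding shift by (simp only: mult.commute)
qed

lemma numerator_eq_filling_sum:
  fixes x :: "nat \<Rightarrow> 'a::field_char_0"
  assumes e: "e = 1 \<or> e = - 1" and x: "\<And>i. 1 \<le> i \<Longrightarrow> i \<le> Suc k \<Longrightarrow> x i \<noteq> 0"
    and a: "\<And>m. m \<le> 0 \<Longrightarrow> a m = 0"
    and decr: "\<forall>i. 1 \<le> i \<and> i \<le> k \<longrightarrow> lam (Suc i) \<le> lam i"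
  shows "numerator e (Suc k) x a lam
    = (if lam (Suc k) = 0 then 1 + e else 1) * pair_vandermonde (Suc k) x * filling_sum e (Suc k) x a lam"
proof -
  have ee: "e * e = 1" using e by auto
  show ?thesis
    using x a decr
  proof (induction k arbitrary: a lam)
    case 0
    have "rows_diagram 0 M = {}" for M by auto
    then have fillings: "filling_sum e 0 x b M = 1" for b M
      by (simp add: filling_sum_def eo_fillings_def zetas_def bars_def filling_weight_def)
    have "row_factor a e (x 1) (lam 1) (lam 1) = pair_pow a e (x 1) (lam 1)"
      by (simp add: row_factor_def pair_pow_def)
    moreover have "numerator e 1 x a lam = pair_pow a e (x 1) (lam 1)"
      by (simp add: numerator_def cdet_def det_single)
    ultimately show ?case
      using last_row_sum[OF ee, of "lam 1" a "x 1" "lam 1"]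
      by (simp add: filling_sum_Suc[OF 0(3)] fillings pair_vandermonde_def Let_def)
  next
    case (Suc k)
    let ?n = "Suc k" and ?t = "x (Suc (Suc k))" and ?l = "lam (Suc (Suc k))"
    let ?s = "\<lambda>M. cdet ?n (\<lambda>j i. shift_pow a e (x (Suc i)) (M j + ?n - j))"
    let ?f = "\<lambda>M. filling_sum e ?n x (\<lambda>m. a (m - 1)) M"
    let ?V = "pair_vandermonde ?n x"
    let ?P = "\<Prod>i<?n. x (Suc i) + inverse (x (Suc i)) - ?t - inverse ?t"
    let ?NN = "\<Pi>\<^sub>E i\<in>{1..?n}. {lam (Suc i)..lam i}"
    let ?MM = "\<lambda>N. \<Pi>\<^sub>E i\<in>{1..?n}. {next_part ?n N i..N i}"
    let ?w = "\<lambda>N M. (\<Prod>i=1..?n. seg a (inverse ?t) (Suc (N i + ?n - i)) (lam i + Suc ?n - i))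
      * (\<Prod>i=1..?n. seg a ?t (M i + ?n - i) (N i + ?n - i))"
    let ?c = "if ?l = 0 then 1 + e else 1"
    define R where "R M = (\<Sum>p\<in>{0, min (M ?n) ?l}. last_row_term a e ?t (M ?n) ?l p)" for M
    have R: "?c * R M = row_factor a e ?t (M ?n) ?l" for M
      unfolding R_def by (rule last_row_sum[OF ee])
    have summand: "row_factor a e ?t (M ?n) ?l * ?s M
        = ?c * ?V * (R M * ?f M)"
      if N: "N \<in> ?NN" and M: "M \<in> ?MM N" for N M
    proof -
      have decrM: "\<forall>i. 1 \<le> i \<and> i \<le> k \<longrightarrow> M (Suc i) \<le> M i"
      proof (intro allI impI)
        fix i assume i: "1 \<le> i \<and> i \<le> k"
        have "next_part ?n N i \<le> M i" "M (Suc i) \<le> N (Suc i)"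
          using PiE_mem[OF M, of i] PiE_mem[OF M, of "Suc i"] i by auto
        then show "M (Suc i) \<le> M i" using i by (simp add: next_part_def)
      qed
      have IH: "numerator e ?n x (\<lambda>m. a (m - 1)) M = (if M ?n = 0 then 1 + e else 1) * ?V * ?f M"
        using Suc.prems by (intro Suc.IH decrM) auto
      have shift: "numerator e ?n x (\<lambda>m. a (m - 1)) M = (if M ?n = 0 then 1 + e else 1) * ?s M"
        using Suc.prems(2) by (intro numerator_shift e) auto
      have "row_factor a e ?t (M ?n) ?l * ?s M = row_factor a e ?t (M ?n) ?l * (?V * ?f M)"
      proof (cases "M ?n = 0 \<and> e = - 1")
        case True
        then show ?thesis by (simp add: row_factor_def fpow_eq_seg)
      next
        case False
        then have "(if M ?n = 0 then 1 + e else 1) \<noteq> 0" using e by auto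
        moreover have "(if M ?n = 0 then 1 + e else 1) * ?s M = (if M ?n = 0 then 1 + e else 1) * (?V * ?f M)"
          using IH shift by (simp only: mult.assoc)
        ultimately show ?thesis by (simp only: mult_cancel_left) simp
      qed
      then show ?thesis
        unfolding R[symmetric] by (simp only: mult_ac)
    qed
    have "numerator e (Suc ?n) x a lam
        = ?P * (\<Sum>N\<in>?NN. \<Sum>M\<in>?MM N. ?w N M * (row_factor a e ?t (M ?n) ?l * ?s M))"
      using Suc.prems by (subst numerator_Suc[OF e]) (auto simp only: mult.assoc)
    also have "\<dots> = ?P * (\<Sum>N\<in>?NN. \<Sum>M\<in>?MM N. ?w N M * (?c * ?V *
        (R M * ?f M)))"
      by (intro arg_cong[where f = "\<lambda>y. ?P * y"] sum.cong[OF refl]) (simp only: summand)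
    also have "\<dots> = ?c * (?V * ?P) * (\<Sum>N\<in>?NN. \<Sum>M\<in>?MM N. ?w N M *
        R M * ?f M)"
      by (simp only: sum_distrib_left mult_ac)
    also have "(\<Sum>N\<in>?NN. \<Sum>M\<in>?MM N. ?w N M *
        R M * ?f M)
        = filling_sum e (Suc ?n) x a lam"
      by (simp only: filling_sum_Suc[OF Suc.prems(3)] Let_def nat.distinct if_False R_def)
    finally show ?case by (simp only: pair_vandermonde_Suc)
  qed
qed

lemma partition_support:
  assumes "is_partition lam"
  shows "{i. 1 \<le> i \<and> 0 < lam i} = {1..part_length lam}"
  unfolding part_length_def
proof (rule initial_segment)
  have step: "lam (Suc i) \<le> lam i" if "1 \<le> i" for i
    using assms that by (simp add: is_partition_def)
  have mono: "lam i \<le> lam j" if "j \<le> i" "1 \<le> j" for i j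
    using that
  proof (induction i rule: dec_induct)
    case (step i)
    then show ?case using \<open>\<And>i. 1 \<le> i \<Longrightarrow> lam (Suc i) \<le> lam i\<close>[of i] by simp
  qed simp
  show "j \<in> {i. 1 \<le> i \<and> 0 < lam i}" if "i \<in> {i. 1 \<le> i \<and> 0 < lam i}" "1 \<le> j" "j \<le> i" for i j
    using that mono[of j i] by auto
qed (use assms in \<open>auto simp: is_partition_def\<close>)

lemma diagram_eq_rows_diagram:
  assumes "is_partition lam" "part_length lam \<le> n"
  shows "diagram lam = rows_diagram n lam"
proof -
  have "i \<le> part_length lam" if "1 \<le> i" "0 < lam i" for i
    using partition_support[OF assms(1)] that by auto
  then show ?thesis
    using assms(2) by (force simp: diagram_def rows_diagram_def)
qed

lemma so_denom_eq:
  fixes x :: "nat \<Rightarrow> 'a::field_char_0"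
  assumes "1 \<le> n" "\<forall>i\<in>{1..n}. x i \<noteq> 0" "\<forall>m\<le>0. a m = 0"
  shows "so_denom n x a = pair_vandermonde n x"
proof -
  obtain k where n: "n = Suc k" using assms(1) by (cases n) auto
  have "rows_diagram n (\<lambda>_. 0) = {}" by auto
  then have "filling_sum 1 n x a (\<lambda>_. 0) = 1"
    by (simp add: filling_sum_def eo_fillings_def zetas_def bars_def filling_weight_def)
  then have "numerator 1 n x a (\<lambda>_. 0) = 2 * pair_vandermonde n x"
    unfolding n using assms by (subst numerator_eq_filling_sum) (auto simp: n)
  moreover have "so_denom n x a = 1 / 2 * numerator 1 n x a (\<lambda>_. 0)"
    by (simp add: so_denom_def numerator_def cdet_def pair_pow_def)
  ultimately show ?thesis by simp
qed

context
  fixes n :: nat and x :: "nat \<Rightarrow> 'a::field_char_0" and a :: "int \<Rightarrow> 'a" and lam :: "nat \<Rightarrow> nat"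
  assumes n: "1 \<le> n" and x: "\<forall>i\<in>{1..n}. x i \<noteq> 0" and denom: "so_denom n x a \<noteq> 0"
    and a: "\<forall>m\<le>0. a m = 0" and lam: "is_partition lam" "part_length lam \<le> n"
begin

lemma numerator_div_so_denom:
  assumes "e = 1 \<or> e = - 1"
  shows "numerator e n x a lam / so_denom n x a = (if lam n = 0 then 1 + e else 1) *
    (\<Sum>T\<in>eo_tableaux n lam. (1 + e) ^ zeta_count lam T * e ^ bar_count lam T * tab_wgt n x a lam T)"
proof -
  obtain k where k: "n = Suc k" using n by (cases n) auto
  have "numerator e n x a lam
    = (if lam n = 0 then 1 + e else 1) * so_denom n x a * filling_sum e n x a lam"
    unfolding so_denom_eq[OF n x a] unfolding k
    using assms x a lam(1) by (intro numerator_eq_filling_sum) (auto simp: k is_partition_def)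
  moreover have "filling_sum e n x a lam
    = (\<Sum>T\<in>eo_tableaux n lam. (1 + e) ^ zeta_count lam T * e ^ bar_count lam T * tab_wgt n x a lam T)"
    unfolding filling_sum_def diagram_eq_rows_diagram[OF lam, symmetric] eo_tableaux_eq[OF refl, symmetric]
    by (simp add: zeta_count_def bar_count_def tab_wgt_def zetas_def bars_def filling_weight_def)
  ultimately show ?thesis using denom by simp
qed

lemma o_char_eq:
  "o_char n x a lam = (\<Sum>T\<in>eo_tableaux n lam. 2 ^ zeta_count lam T * tab_wgt n x a lam T)"
proof -
  have "det_plus n x a lam = numerator 1 n x a lam"
    by (simp add: det_plus_def numerator_def cdet_def pair_pow_def)
  then have "o_char n x a lam
      = (if lam n = 0 then 1 / 2 else 1) * (numerator 1 n x a lam / so_denom n x a)"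
    by (simp add: o_char_def)
  also have "\<dots> = (\<Sum>T\<in>eo_tableaux n lam. 2 ^ zeta_count lam T * tab_wgt n x a lam T)"
    by (subst numerator_div_so_denom) simp_all
  finally show ?thesis .
qed

lemma o'_char_eq:
  assumes "0 < lam n"
  shows "o'_char n x a lam
    = (\<Sum>T\<in>eo_tableaux n lam. 0 ^ zeta_count lam T * (- 1) ^ bar_count lam T * tab_wgt n x a lam T)"
proof -
  have "det_minus n x a lam = numerator (- 1) n x a lam"
    by (simp add: det_minus_def numerator_def cdet_def pair_pow_def)
  then show ?thesis
    using numerator_div_so_denom[of "- 1"] assms by (simp add: o'_char_def)
qed

end

theorem theorem4:
  fixes n :: nat
    and x :: "nat \<Rightarrow> 'a::field_char_0"
    and a :: "int \<Rightarrow> 'a"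
    and lam :: "nat \<Rightarrow> nat"
  assumes "n \<ge> 1"
    and "\<forall>i\<in>{1..n}. x i \<noteq> 0"
    and "so_denom n x a \<noteq> 0"
    and "\<forall>m\<le>0. a m = 0"
    and "is_partition lam"
    and "part_length lam \<le> n"
  shows "(part_length lam < n \<longrightarrow>
            so_char n x a (\<lambda>i. int (lam i)) =
              (\<Sum>T\<in>eo_tableaux n lam. 2 ^ zeta_count lam T * tab_wgt n x a lam T))
       \<and> (part_length lam = n \<longrightarrow>
            so_char n x a (weight_plus lam) =
              (\<Sum>T\<in>eo_tableaux n lam.
                 (of_bool (zeta_count lam T > 0) * 2 ^ (zeta_count lam T - 1)
                  + of_bool (zeta_count lam T = 0) * (1 / 2 * (1 + (- 1) ^ bar_count lam T)))
                 * tab_wgt n x a lam T)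
          \<and> so_char n x a (weight_minus n lam) =
              (\<Sum>T\<in>eo_tableaux n lam.
                 (of_bool (zeta_count lam T > 0) * 2 ^ (zeta_count lam T - 1)
                  + of_bool (zeta_count lam T = 0) * (1 / 2 * (1 - (- 1) ^ bar_count lam T)))
                 * tab_wgt n x a lam T))"
proof (intro conjI impI)
  assume "part_length lam < n"
  then show "so_char n x a (\<lambda>i. int (lam i)) =
      (\<Sum>T\<in>eo_tableaux n lam. 2 ^ zeta_count lam T * tab_wgt n x a lam T)"
    by (simp add: so_char_def o_char_eq[OF assms])
next
  assume full: "part_length lam = n"
  have "n \<in> {i. 1 \<le> i \<and> 0 < lam i}"
    unfolding partition_support[OF assms(5)] full using assms(1) by simp
  then have pos: "0 < lam n" by simp
  note chars = o_char_eq[OF assms] o'_char_eq[OF assms pos]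
  have half_power: "(of_bool (0 < z) * 2 ^ (z - 1) + of_bool (z = 0) * (1 / 2 * (1 + c))) * w
      = 1 / 2 * (2 ^ z * w + 0 ^ z * c * w)"
    "(of_bool (0 < z) * 2 ^ (z - 1) + of_bool (z = 0) * (1 / 2 * (1 - c))) * w
      = 1 / 2 * (2 ^ z * w - 0 ^ z * c * w)" for z and c w :: 'a
    by (cases z; simp add: algebra_simps)+
  have "so_char n x a (weight_plus lam) = 1 / 2 * (o_char n x a lam + o'_char n x a lam)"
    using pos full by (simp add: so_char_def weight_plus_def)
  then show "so_char n x a (weight_plus lam) =
      (\<Sum>T\<in>eo_tableaux n lam.
         (of_bool (zeta_count lam T > 0) * 2 ^ (zeta_count lam T - 1)
          + of_bool (zeta_count lam T = 0) * (1 / 2 * (1 + (- 1) ^ bar_count lam T)))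
         * tab_wgt n x a lam T)"
    by (simp only: chars half_power sum_distrib_left[symmetric] sum.distrib)
  have "(\<lambda>i. nat \<bar>weight_minus n lam i\<bar>) = lam"
    by (auto simp: weight_minus_def)
  moreover have "\<not> 0 < weight_minus n lam n"
    by (simp add: weight_minus_def)
  ultimately have "so_char n x a (weight_minus n lam) = 1 / 2 * (o_char n x a lam - o'_char n x a lam)"
    using full by (simp add: so_char_def)
  then show "so_char n x a (weight_minus n lam) =
      (\<Sum>T\<in>eo_tableaux n lam.
         (of_bool (zeta_count lam T > 0) * 2 ^ (zeta_count lam T - 1)
          + of_bool (zeta_count lam T = 0) * (1 / 2 * (1 - (- 1) ^ bar_count lam T)))
         * tab_wgt n x a lam T)"
    by (simp only: chars half_power sum_distrib_left[symmetric] sum_subtractf)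
qed

end
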